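(* There exist $\beta_0>0$ and $L>0$ such that for all $\beta\le\beta_0$, all $N\ge1$, all $(t_1,\dots,t_N)$ with $\sum_{i\le N}t_i^2=1$ and all integers $k\ge1$, $$\nu\Bigl(\Bigl(\sum_{i=1}^N t_i\bar\sigma_i\Bigr)^{2k}\Bigr)\le (Lk)^k,$$ where $\bar\sigma=\sigma^1-\sigma^2$.
   Context: Sherrington–Kirkpatrick model: $\Sigma_N=\{-1,1\}^N$; $(g_{ij})$ i.i.d. standard Gaussians; $\beta>0,h\ge0$; $-H_N(\sigma)=\frac{\beta}{\sqrt N}\sum_{1\le i<j\le N}g_{ij}\sigma_i\sigma_j+h\sum_i\sigma_i$; Gibbs measure $G\propto e^{-H_N}$. $\sigma^1,\sigma^2$ are two independent replicas (i.i.d. with law $G$ given the disorder), $\langle\cdot\rangle$ the Gibbs expectation over replicas, and $\nu(f)=\mathbb{E}\langle f\rangle$ with $\mathbb{E}$ over the disorder. *)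

theory Defs
  imports "HOL-Probability.Probability"
begin

definition std_gauss :: "real measure" where
  "std_gauss = density lborel std_normal_density"

definition pairs :: "nat \<Rightarrow> (nat \<times> nat) set" where
  "pairs N = {(i, j). i < j \<and> j < N}"

definition disorder :: "nat \<Rightarrow> ((nat \<times> nat) \<Rightarrow> real) measure" where
  "disorder N = PiM (pairs N) (\<lambda>_. std_gauss)"

definition configs :: "nat \<Rightarrow> (nat \<Rightarrow> real) set" where
  "configs N = {\<sigma>. (\<forall>i<N. \<sigma> i = -1 \<or> \<sigma> i = 1) \<and> (\<forall>i\<ge>N. \<sigma> i = 0)}"

text \<open>minus the SK Hamiltonian, -H_N(sigma).\<close>
definition minusH :: "nat \<Rightarrow> real \<Rightarrow> real \<Rightarrow> ((nat \<times> nat) \<Rightarrow> real) \<Rightarrow> (nat \<Rightarrow> real) \<Rightarrow> real" where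
  "minusH N \<beta> h g \<sigma> =
     \<beta> / sqrt (real N) * (\<Sum>i<N. \<Sum>j\<in>{i<..<N}. g (i, j) * \<sigma> i * \<sigma> j)
     + h * (\<Sum>i<N. \<sigma> i)"

definition Zpart :: "nat \<Rightarrow> real \<Rightarrow> real \<Rightarrow> ((nat \<times> nat) \<Rightarrow> real) \<Rightarrow> real" where
  "Zpart N \<beta> h g = (\<Sum>\<sigma>\<in>configs N. exp (minusH N \<beta> h g \<sigma>))"

definition gibbs2 :: "nat \<Rightarrow> real \<Rightarrow> real \<Rightarrow> ((nat \<times> nat) \<Rightarrow> real)
      \<Rightarrow> ((nat \<Rightarrow> real) \<Rightarrow> (nat \<Rightarrow> real) \<Rightarrow> real) \<Rightarrow> real" where
  "gibbs2 N \<beta> h g f =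
     (\<Sum>\<sigma>1\<in>configs N. \<Sum>\<sigma>2\<in>configs N.
        f \<sigma>1 \<sigma>2 * exp (minusH N \<beta> h g \<sigma>1) * exp (minusH N \<beta> h g \<sigma>2))
     / (Zpart N \<beta> h g)\<^sup>2"

definition nu :: "nat \<Rightarrow> real \<Rightarrow> real \<Rightarrow> ((nat \<Rightarrow> real) \<Rightarrow> (nat \<Rightarrow> real) \<Rightarrow> real) \<Rightarrow> real" where
  "nu N \<beta> h f = (\<integral>g. gibbs2 N \<beta> h g f \<partial>disorder N)"

end

theory Submission
  imports Defs "HOL-Real_Asymp.Real_Asymp"
begin

text \<open>Write the Hamiltonian as \<open>\<beta> / (2 * sqrt N)\<close> times the quadratic form of the symmetric coupling matrix.
  Up to probability \<open>2 * exp (-N)\<close> this form is at most \<open>34 * sqrt N * |x|\<^sup>2\<close> in absolute value (union bound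
  over a lattice net). On the exceptional event the trivial bound \<open>(4 * N) ^ k\<close> suffices, since
  \<open>N ^ k * exp (-N) \<le> k!\<close>. Otherwise, for small \<open>\<beta>\<close>, adding a multiple of the identity (a constant on
  configurations) makes the interaction positive definite and at most 1/2, so by Cholesky it is a sum of
  squares of linear forms, and Hubbard-Stratonovich turns the partition function with external field
  \<open>h + l * t\<close> into a Gaussian integral of a product of hyperbolic cosines. The integrand times \<open>exp (- l\<^sup>2)\<close>
  is jointly log-concave in the integration variables and \<open>l\<close>, a property preserved by the
  Prekopa-Leindler inequality. Hence \<open>Z l * Z (-l) \<le> exp (2 * l\<^sup>2) * (Z 0)\<^sup>2\<close>: the difference of
  two replicas in the direction \<open>t\<close> is sub-Gaussian under the Gibbs measure.\<close>

section \<open>The Prekopa-Leindler inequality on the line\<close>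

lemma emeasure_lborel_image_plus:
  fixes A :: "real set" assumes "A \<in> sets borel"
  shows "emeasure lborel ((+) c ` A) = emeasure lborel A"
proof -
  have eq: "(+) c ` A = (+) (-c) -` A" by (auto simp: image_iff algebra_simps) (metis diff_add_cancel)
  have "emeasure lborel A = emeasure (distr lborel borel ((+) (-c))) A"
    by (simp add: lborel_distr_plus)
  also have "\<dots> = emeasure lborel ((+) (-c) -` A \<inter> space lborel)"
    using assms by (intro emeasure_distr) auto
  finally show ?thesis using eq by simp
qed

text \<open>The translates of \<open>A\<close> by the minimum of \<open>B\<close> and of
  \<open>B\<close> by the maximum of \<open>A\<close> both lie in the sumset and meet only at
  \<open>a + b\<close>, a null set, so their measures add up.\<close>

lemma brunn_minkowski_real:
  fixes A B :: "real set"
  assumes A: "compact A" "A \<noteq> {}" and B: "compact B" "B \<noteq> {}"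
  shows "emeasure lborel A + emeasure lborel B \<le> emeasure lborel {x + y | x y. x \<in> A \<and> y \<in> B}"
    (is "_ \<le> emeasure lborel ?S")
proof -
  obtain a where a: "a \<in> A" "\<And>x. x \<in> A \<Longrightarrow> x \<le> a"
    using continuous_attains_sup[OF A, of "\<lambda>x. x"] by auto
  obtain b where b: "b \<in> B" "\<And>x. x \<in> B \<Longrightarrow> b \<le> x"
    using continuous_attains_inf[OF B, of "\<lambda>x. x"] by auto
  have bA: "A \<in> sets borel" and bB: "B \<in> sets borel"
    using A B by (auto intro: borel_compact)
  have cA: "compact ((+) b ` A)" and cB: "compact ((+) a ` B)"
    using A B by (auto intro: compact_translation)
  have sub: "(+) b ` A \<union> (+) a ` B \<subseteq> ?S"
    using a(1) b(1) by (auto; metis add.commute)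
  have S: "?S \<in> sets lborel"
    using compact_sums[OF A(1) B(1)] by (auto intro: borel_compact)
  have inter: "(+) b ` A \<inter> (+) a ` B \<subseteq> {a + b}"
  proof
    fix z assume "z \<in> (+) b ` A \<inter> (+) a ` B"
    then obtain x y where "x \<in> A" "y \<in> B" "z = b + x" "z = a + y" by auto
    then show "z \<in> {a + b}" using a(2)[of x] b(2)[of y] by auto
  qed
  have bcA: "(+) b ` A \<in> sets lborel" and bcB: "(+) a ` B \<in> sets lborel"
    using cA cB by (auto intro: borel_compact)
  have null: "emeasure lborel ((+) b ` A - {a + b}) = emeasure lborel ((+) b ` A)"
    by (rule emeasure_Diff_null_set) (use bcA in auto)
  have "emeasure lborel A + emeasure lborel B
      = emeasure lborel ((+) b ` A - {a + b}) + emeasure lborel ((+) a ` B)"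
    by (simp add: null emeasure_lborel_image_plus bA bB)
  also have "\<dots> = emeasure lborel (((+) b ` A - {a + b}) \<union> (+) a ` B)"
    by (rule plus_emeasure) (use bcA bcB inter in auto)
  also have "\<dots> \<le> emeasure lborel ?S"
    by (rule emeasure_mono) (use sub S in auto)
  finally show ?thesis .
qed

text \<open>Fubini for the region under the graph, \<open>f x\<close> being the length of
  \<open>{0<..f x}\<close>.\<close>

lemma nn_integral_layer_cake:
  fixes f :: "real \<Rightarrow> real"
  assumes f[measurable]: "f \<in> borel_measurable borel" and pos: "\<And>x. 0 \<le> f x"
  shows "(\<integral>\<^sup>+x. ennreal (f x) \<partial>lborel) = (\<integral>\<^sup>+s. emeasure lborel {x. s \<le> f x} * indicator {0<..} s \<partial>lborel)"
proof -
  have "(\<integral>\<^sup>+x. ennreal (f x) \<partial>lborel) = (\<integral>\<^sup>+x. (\<integral>\<^sup>+s. indicator {0<..f x} s \<partial>lborel) \<partial>lborel)"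
    by (intro nn_integral_cong) (simp add: pos)
  also have "\<dots> = (\<integral>\<^sup>+x. (\<integral>\<^sup>+s. (if 0 < s \<and> s \<le> f x then 1 else 0) \<partial>lborel) \<partial>lborel)"
    by (intro nn_integral_cong) (auto simp: indicator_def)
  also have "\<dots> = (\<integral>\<^sup>+s. (\<integral>\<^sup>+x. (if 0 < s \<and> s \<le> f x then 1 else 0) \<partial>lborel) \<partial>lborel)"
    by (rule lborel_pair.Fubini') measurable
  also have "\<dots> = (\<integral>\<^sup>+s. emeasure lborel {x. s \<le> f x} * indicator {0<..} s \<partial>lborel)"
  proof (intro nn_integral_cong)
    fix s :: real
    have "(\<integral>\<^sup>+x. (if 0 < s \<and> s \<le> f x then 1 else 0) \<partial>lborel)
        = (\<integral>\<^sup>+x. indicator {0<..} s * indicator {x. s \<le> f x} x \<partial>lborel)"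
      by (intro nn_integral_cong) (auto simp: indicator_def)
    also have "\<dots> = indicator {0<..} s * emeasure lborel {x. s \<le> f x}"
      by (rule nn_integral_cmult_indicator) measurable
    finally show "(\<integral>\<^sup>+x. (if 0 < s \<and> s \<le> f x then 1 else 0) \<partial>lborel) = emeasure lborel {x. s \<le> f x} * indicator {0<..} s"
      by (simp add: mult.commute)
  qed
  finally show ?thesis .
qed

lemma compact_superlevel:
  fixes f :: "real \<Rightarrow> real"
  assumes cont: "continuous_on UNIV f" and lim: "(f \<longlongrightarrow> 0) at_infinity" and s: "s > 0"
  shows "compact {x. s \<le> f x}"
proof -
  have "eventually (\<lambda>x. f x < s) at_infinity"
    using order_tendstoD(2)[OF lim s] .
  then obtain b where b: "\<And>x. b \<le> norm x \<Longrightarrow> f x < s"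
    by (auto simp: eventually_at_infinity)
  have "{x. s \<le> f x} \<subseteq> cball 0 b"
  proof
    fix x assume "x \<in> {x. s \<le> f x}"
    then show "x \<in> cball 0 b" using b[of x] by (cases "b \<le> norm x") auto
  qed
  then have "bounded {x. s \<le> f x}" using bounded_subset bounded_cball by blast
  moreover have "closed {x. s \<le> f x}"
    by (rule closed_Collect_le) (use cont in auto)
  ultimately show ?thesis by (simp add: compact_eq_bounded_closed)
qed

text \<open>A maximum over the compact set where \<open>f\<close> is at least \<open>f 0\<close> is
  global, because every other point has a smaller value than 0 has.\<close>

lemma attains_max_vanishing_at_infinity:
  fixes f :: "real \<Rightarrow> real"
  assumes cont: "continuous_on UNIV f" and lim: "(f \<longlongrightarrow> 0) at_infinity" and pos: "\<And>x. 0 < f x"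
  obtains m where "\<And>x. f x \<le> f m"
proof -
  have "compact {x. f 0 \<le> f x}" using compact_superlevel[OF cont lim pos] .
  moreover have "0 \<in> {x. f 0 \<le> f x}" by simp
  ultimately obtain m where m: "m \<in> {x. f 0 \<le> f x}" "\<And>x. x \<in> {x. f 0 \<le> f x} \<Longrightarrow> f x \<le> f m"
    using continuous_attains_sup[of "{x. f 0 \<le> f x}" f] continuous_on_subset[OF cont] by (metis empty_iff subset_UNIV)
  have "f x \<le> f m" for x
    using m(1) m(2)[of x] by (cases "f 0 \<le> f x") auto
  then show ?thesis using that by blast
qed

text \<open>The functions are normalised to have maximum 1, so that for every level in (0, 1] both
  superlevel sets are nonempty and Brunn-Minkowski applies.\<close>

lemma prekopa_leindler_normalised:
  fixes u v w :: "real \<Rightarrow> real"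
  assumes cu: "continuous_on UNIV u" and lu: "(u \<longlongrightarrow> 0) at_infinity" and pu: "\<And>x. 0 < u x"
    and mu: "u a = 1" "\<And>x. u x \<le> 1"
    and cv: "continuous_on UNIV v" and lv: "(v \<longlongrightarrow> 0) at_infinity" and pv: "\<And>x. 0 < v x"
    and mv: "v b = 1" "\<And>x. v x \<le> 1"
    and cw: "continuous_on UNIV w" and pw: "\<And>x. 0 \<le> w x"
    and le: "\<And>x y. u x * v y \<le> (w (x + y))\<^sup>2"
  shows "(\<integral>\<^sup>+x. ennreal (u x) \<partial>lborel) + (\<integral>\<^sup>+x. ennreal (v x) \<partial>lborel) \<le> (\<integral>\<^sup>+x. ennreal (w x) \<partial>lborel)"
proof -
  have [measurable]: "u \<in> borel_measurable borel" "v \<in> borel_measurable borel" "w \<in> borel_measurable borel"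
    using cu cv cw by (auto intro: borel_measurable_continuous_onI)
  have level: "emeasure lborel {x. s \<le> u x} * indicator {0<..} s + emeasure lborel {x. s \<le> v x} * indicator {0<..} s
      \<le> emeasure lborel {x. s \<le> w x} * indicator {0<..} s" for s :: real
  proof -
    consider "s \<le> 0" | "s > 1" | "0 < s" "s \<le> 1" by linarith
    then show ?thesis
    proof cases
      case 1 then show ?thesis by simp
    next
      case 2
      then have "{x. s \<le> u x} = {}" "{x. s \<le> v x} = {}"
        using mu(2) mv(2) by (auto simp: not_le intro: le_less_trans)
      then show ?thesis by simp
    next
      case 3
      let ?A = "{x. s \<le> u x}" and ?B = "{x. s \<le> v x}"
      have "emeasure lborel ?A + emeasure lborel ?B \<le> emeasure lborel {x + y | x y. x \<in> ?A \<and> y \<in> ?B}"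
        using 3 compact_superlevel[OF cu lu] compact_superlevel[OF cv lv] mu(1) mv(1)
        by (intro brunn_minkowski_real) (auto intro: exI[of _ a] exI[of _ b])
      also have "\<dots> \<le> emeasure lborel {x. s \<le> w x}"
      proof (rule emeasure_mono)
        show "{x + y | x y. x \<in> ?A \<and> y \<in> ?B} \<subseteq> {x. s \<le> w x}"
        proof clarify
          fix x y assume "s \<le> u x" "s \<le> v y"
          then have "s\<^sup>2 \<le> u x * v y" using 3 by (simp add: power2_eq_square mult_mono)
          also have "\<dots> \<le> (w (x + y))\<^sup>2" by (rule le)
          finally show "s \<le> w (x + y)" using pw by (rule power2_le_imp_le)
        qed
      qed measurable
      finally show ?thesis using 3 by simp
    qed
  qed
  have "(\<integral>\<^sup>+x. ennreal (u x) \<partial>lborel) + (\<integral>\<^sup>+x. ennreal (v x) \<partial>lborel) =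
    (\<integral>\<^sup>+s. emeasure lborel {x. s \<le> u x} * indicator {0<..} s + emeasure lborel {x. s \<le> v x} * indicator {0<..} s \<partial>lborel)"
    by (subst (1 2) nn_integral_layer_cake) (auto simp: less_imp_le[OF pu] less_imp_le[OF pv] nn_integral_add)
  also have "\<dots> \<le> (\<integral>\<^sup>+s. emeasure lborel {x. s \<le> w x} * indicator {0<..} s \<partial>lborel)"
    by (intro nn_integral_mono level)
  also have "\<dots> = (\<integral>\<^sup>+x. ennreal (w x) \<partial>lborel)"
    by (rule nn_integral_layer_cake[symmetric]) (auto simp: pw)
  finally show ?thesis .
qed

text \<open>Dividing by the maxima leads to the normalised case, which bounds a sum of integrals;
  the inequality of arithmetic and geometric means turns that sum into the product.\<close>

lemma prekopa_leindler_midpoint: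
  fixes f g k :: "real \<Rightarrow> real"
  assumes f: "continuous_on UNIV f" "(f \<longlongrightarrow> 0) at_infinity" "\<And>x. 0 < f x" "integrable lborel f"
    and g: "continuous_on UNIV g" "(g \<longlongrightarrow> 0) at_infinity" "\<And>x. 0 < g x" "integrable lborel g"
    and k: "continuous_on UNIV k" "\<And>x. 0 \<le> k x" "integrable lborel k"
    and le: "\<And>x y. f x * g y \<le> (k ((x + y) / 2))\<^sup>2"
  shows "(\<integral>x. f x \<partial>lborel) * (\<integral>x. g x \<partial>lborel) \<le> (\<integral>x. k x \<partial>lborel)\<^sup>2"
proof -
  obtain a where a: "\<And>x. f x \<le> f a" using attains_max_vanishing_at_infinity[OF f(1-3)] by blast
  obtain b where b: "\<And>x. g x \<le> g b" using attains_max_vanishing_at_infinity[OF g(1-3)] by blast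
  note pos = f(3)[of a] g(3)[of b]
  \<comment> \<open>The geometric mean of the two maxima is the scale for \<open>k\<close> that
    preserves the pointwise hypothesis.\<close>
  define r where "r = sqrt (f a * g b)"
  have r: "r > 0" "r\<^sup>2 = f a * g b" using pos by (auto simp: r_def)
  define K where "K = (\<integral>x. k x \<partial>lborel)"
  define I where "I = (\<integral>x. f x \<partial>lborel)"
  define J where "J = (\<integral>x. g x \<partial>lborel)"
  have nonneg: "0 \<le> K" "0 \<le> I" "0 \<le> J"
    unfolding K_def I_def J_def using k f g by (auto intro!: integral_nonneg_AE simp: less_imp_le)
  have ik: "integrable lborel (\<lambda>x. k (x / 2))"
    using lborel_integrable_real_affine[OF k(3), of "1/2" 0] by simp
  \<comment> \<open>Passing from the midpoint to the sum \<open>x + y\<close> doubles the integral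
    of \<open>k\<close>; the square of this 2 cancels the 4 of the mean inequality below.\<close>
  have Ik: "(\<integral>x. k (x / 2) \<partial>lborel) = 2 * K"
    using lborel_integral_real_affine[of "1/2" k 0] by (simp add: K_def)
  have "(\<integral>\<^sup>+x. ennreal (f x / f a) \<partial>lborel) + (\<integral>\<^sup>+x. ennreal (g x / g b) \<partial>lborel)
      \<le> (\<integral>\<^sup>+x. ennreal (k (x / 2) / r) \<partial>lborel)"
  proof (rule prekopa_leindler_normalised)
    show "continuous_on UNIV (\<lambda>x. f x / f a)" "continuous_on UNIV (\<lambda>x. g x / g b)"
      using f(1) g(1) pos by (auto intro!: continuous_intros)
    show "continuous_on UNIV (\<lambda>x. k (x / 2) / r)"
      using r by (auto intro!: continuous_intros continuous_on_compose2[OF k(1)])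
    show "((\<lambda>x. f x / f a) \<longlongrightarrow> 0) at_infinity" "((\<lambda>x. g x / g b) \<longlongrightarrow> 0) at_infinity"
      using tendsto_divide[OF f(2) tendsto_const] tendsto_divide[OF g(2) tendsto_const] pos
      by fastforce+
    show "f x / f a * (g y / g b) \<le> (k ((x + y) / 2) / r)\<^sup>2" for x y
      using le[of x y] pos r by (simp add: power_divide divide_right_mono)
  qed (use f(3) g(3) a b pos r k(2) in \<open>auto simp: less_imp_neq[THEN not_sym]\<close>)
  then have "ennreal (I / f a) + ennreal (J / g b) \<le> ennreal (2 * K / r)"
    using f(3,4) g(3,4) k(2) ik Ik r pos unfolding I_def J_def
    by (subst (asm) (1 2 3) nn_integral_eq_integral) (auto simp: less_imp_le)
  then have "I / f a + J / g b \<le> 2 * K / r"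
    using nonneg r pos by (simp flip: ennreal_plus)
  then have "(I / f a + J / g b)\<^sup>2 \<le> (2 * K / r)\<^sup>2"
    using nonneg pos by (intro power_mono) auto
  moreover have "4 * (I / f a * (J / g b)) \<le> (I / f a + J / g b)\<^sup>2"
    using sum_squares_bound[of "I / f a" "J / g b"] by (simp add: power2_sum)
  ultimately have "4 * (I / f a * (J / g b)) \<le> 4 * K\<^sup>2 / r\<^sup>2"
    by (simp add: power_divide power_mult_distrib)
  then have "4 * (I * J / (f a * g b)) \<le> 4 * (K\<^sup>2 / (f a * g b))" by (simp add: r(2))
  then show ?thesis using pos unfolding I_def J_def K_def by (simp add: divide_le_cancel)
qed

section \<open>Hubbard-Stratonovich transformation\<close>

text \<open>Completing the square: the integrand is a multiple of the normal density centred at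
  \<open>b\<close>.\<close>

lemma gaussian_exp_linear:
  fixes b :: real
  shows "has_bochner_integral lborel (\<lambda>x. exp (x * b - x\<^sup>2 / 2)) (sqrt (2 * pi) * exp (b\<^sup>2 / 2))"
proof -
  have eq: "exp (x * b - x\<^sup>2 / 2) = sqrt (2 * pi) * exp (b\<^sup>2 / 2) * normal_density b 1 x" for x
    by (simp add: normal_density_def power2_eq_square field_simps flip: exp_add)
  show ?thesis
    unfolding eq
    using has_bochner_integral_mult_right[of "sqrt (2 * pi) * exp (b\<^sup>2 / 2)" lborel "normal_density b 1" 1]
    by (simp add: has_bochner_integral_iff)
qed

text \<open>Supplies the regularity that Prekopa-Leindler demands of a one-variable slice of
  \<open>hs_sum\<close>, together with the integral of that slice.\<close>

lemma gaussian_mixture: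
  fixes q c :: "'s \<Rightarrow> real"
  assumes S: "finite S" "S \<noteq> {}" and q: "\<And>s. s \<in> S \<Longrightarrow> 0 < q s"
  defines "f \<equiv> \<lambda>x. \<Sum>s\<in>S. q s * exp (x * c s - x\<^sup>2 / 2)"
  shows "continuous_on UNIV f" "(f \<longlongrightarrow> 0) at_infinity" "0 < f x" "integrable lborel f"
    "(\<integral>x. f x \<partial>lborel) = sqrt (2 * pi) * (\<Sum>s\<in>S. q s * exp ((c s)\<^sup>2 / 2))"
proof -
  show "continuous_on UNIV f" unfolding f_def by (intro continuous_intros) auto
  have "((\<lambda>x. exp (x * b - x\<^sup>2 / 2)) \<longlongrightarrow> 0) at_infinity" for b :: real
    unfolding at_infinity_eq_at_top_bot
    by (intro filterlim_sup; real_asymp)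
  then have "(f \<longlongrightarrow> (\<Sum>s\<in>S. q s * 0)) at_infinity"
    unfolding f_def by (intro tendsto_intros)
  then show "(f \<longlongrightarrow> 0) at_infinity" by simp
  show "0 < f x" unfolding f_def using S q by (intro sum_pos) auto
  have "has_bochner_integral lborel f (\<Sum>s\<in>S. q s * (sqrt (2 * pi) * exp ((c s)\<^sup>2 / 2)))"
    unfolding f_def by (intro has_bochner_integral_sum has_bochner_integral_mult_right gaussian_exp_linear)
  then show "integrable lborel f"
    "(\<integral>x. f x \<partial>lborel) = sqrt (2 * pi) * (\<Sum>s\<in>S. q s * exp ((c s)\<^sup>2 / 2))"
    by (auto simp: has_bochner_integral_iff sum_distrib_left algebra_simps)
qed

text \<open>Since \<open>exp (a\<^sup>2 / 2)\<close> is the Gaussian average of \<open>exp (x * a)\<close>, each \<open>hs_sum p a S n (Suc m)\<close> is up to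
  a factor \<open>sqrt (2 * pi)\<close> the integral of \<open>hs_sum p a S n m\<close> over the coordinate \<open>v m\<close>
  (Hubbard-Stratonovich, one coordinate at a time).\<close>

definition hs_sum ::
  "('s \<Rightarrow> real \<Rightarrow> real) \<Rightarrow> (nat \<Rightarrow> 's \<Rightarrow> real) \<Rightarrow> 's set \<Rightarrow> nat \<Rightarrow> nat \<Rightarrow> (nat \<Rightarrow> real) \<Rightarrow> real \<Rightarrow> real" where
  "hs_sum p a S n m v l = (\<Sum>s\<in>S. p s l *
     exp ((\<Sum>j<m. (a j s)\<^sup>2 / 2) + (\<Sum>j\<in>{m..<n}. v j * a j s - (v j)\<^sup>2 / 2)))"

text \<open>With the other coordinates frozen, integrating out coordinate \<open>m\<close> is one
  Prekopa-Leindler step. It applies because \<open>mid\<close> moves all coordinates and the field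
  to their midpoints jointly.\<close>

lemma hs_sum_midpoint_Suc:
  assumes S: "finite S" "S \<noteq> {}" and p: "\<And>s l. 0 < p s l" and "m < n"
    and mid: "\<And>v w l r. hs_sum p a S n m v l * hs_sum p a S n m w r
                \<le> (hs_sum p a S n m (\<lambda>j. (v j + w j) / 2) ((l + r) / 2))\<^sup>2"
  shows "hs_sum p a S n (Suc m) v l * hs_sum p a S n (Suc m) w r
           \<le> (hs_sum p a S n (Suc m) (\<lambda>j. (v j + w j) / 2) ((l + r) / 2))\<^sup>2"
proof -
  \<comment> \<open>\<open>q\<close> collects the factors free of coordinate \<open>m\<close>, so
    that \<open>f\<close> is a Gaussian mixture in that coordinate.\<close>
  define q where "q v l s = p s l *
     exp ((\<Sum>j<m. (a j s)\<^sup>2 / 2) + (\<Sum>j\<in>{Suc m..<n}. v j * a j s - (v j)\<^sup>2 / 2))" for v l s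
  define f where "f v l = (\<lambda>x. \<Sum>s\<in>S. q v l s * exp (x * a m s - x\<^sup>2 / 2))" for v l
  have q: "0 < q v l s" for v l s by (simp add: q_def p)
  have f_eq: "hs_sum p a S n m (v(m := x)) l = f v l x" for v l x
  proof -
    have "(\<Sum>j\<in>{m..<n}. (v(m := x)) j * a j s - ((v(m := x)) j)\<^sup>2 / 2)
        = (x * a m s - x\<^sup>2 / 2) + (\<Sum>j\<in>{Suc m..<n}. v j * a j s - (v j)\<^sup>2 / 2)" for s
      using \<open>m < n\<close> by (simp add: sum.atLeast_Suc_lessThan)
    then show ?thesis
      by (simp add: hs_sum_def f_def q_def exp_add mult_ac)
  qed
  note gm = gaussian_mixture[OF S q, where c = "a m"]
  have f: "continuous_on UNIV (f v l)" "(f v l \<longlongrightarrow> 0) at_infinity" "0 < f v l x" "integrable lborel (f v l)" for v l x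
    unfolding f_def by (rule gm; assumption?)+
  have int: "(\<integral>x. f v l x \<partial>lborel) = sqrt (2 * pi) * hs_sum p a S n (Suc m) v l" for v l
    unfolding f_def gm(5) by (simp add: hs_sum_def q_def exp_add mult_ac)
  have "(\<integral>x. f v l x \<partial>lborel) * (\<integral>x. f w r x \<partial>lborel)
     \<le> (\<integral>x. f (\<lambda>j. (v j + w j) / 2) ((l + r) / 2) x \<partial>lborel)\<^sup>2"
  proof (rule prekopa_leindler_midpoint)
    show "f v l x * f w r y \<le> (f (\<lambda>j. (v j + w j) / 2) ((l + r) / 2) ((x + y) / 2))\<^sup>2" for x y
    proof -
      have "(\<lambda>j. ((v(m := x)) j + (w(m := y)) j) / 2) = (\<lambda>j. (v j + w j) / 2)(m := (x + y) / 2)"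
        by auto
      then show ?thesis
        using mid[of "v(m := x)" l "w(m := y)" r] by (simp add: f_eq del: fun_upd_apply)
    qed
  qed (use f in \<open>auto simp: less_imp_le\<close>)
  moreover have "(sqrt (2 * pi) * x) * (sqrt (2 * pi) * y) = 2 * pi * (x * y)" for x y
    using real_sqrt_mult_self[of "2 * pi"] by (simp add: mult_ac)
  ultimately show ?thesis by (simp add: int power_mult_distrib)
qed

lemma hs_sum_midpoint:
  assumes S: "finite S" "S \<noteq> {}" and p: "\<And>s l. 0 < p s l"
    and mid: "\<And>v w l r. hs_sum p a S n 0 v l * hs_sum p a S n 0 w r
                \<le> (hs_sum p a S n 0 (\<lambda>j. (v j + w j) / 2) ((l + r) / 2))\<^sup>2"
  shows "m \<le> n \<Longrightarrow> hs_sum p a S n m v l * hs_sum p a S n m w r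
           \<le> (hs_sum p a S n m (\<lambda>j. (v j + w j) / 2) ((l + r) / 2))\<^sup>2"
proof (induction m arbitrary: v w l r)
  case 0 show ?case by (rule mid)
next
  case (Suc m)
  then show ?case by (intro hs_sum_midpoint_Suc S p) auto
qed

section \<open>Ising partition functions with small positive definite interaction\<close>

text \<open>The derivative of \<open>x\<^sup>2 / 2 - ln (cosh x)\<close> is
  \<open>x - tanh x\<close>, which is nonnegative for \<open>x \<ge> 0\<close>; evenness covers the
  rest.\<close>

lemma cosh_le_exp_half_square: "cosh x \<le> exp (x\<^sup>2 / 2)" for x :: real
proof -
  have tanh_le: "tanh y \<le> y" if "y \<ge> 0" for y :: real
  proof -
    have "0 - tanh 0 \<le> y - tanh y"
    proof (rule DERIV_nonneg_imp_nondecreasing[OF that, of "\<lambda>x. x - tanh x"])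
      fix x :: real
      have "((\<lambda>x. x - tanh x) has_real_derivative (tanh x)\<^sup>2) (at x)"
        by (auto intro!: derivative_eq_intros simp: field_simps power2_eq_square)
      then show "\<exists>d. ((\<lambda>x. x - tanh x) has_real_derivative d) (at x) \<and> 0 \<le> d"
        by (meson zero_le_power2)
    qed
    then show ?thesis by simp
  qed
  have main: "cosh y \<le> exp (y\<^sup>2 / 2)" if "y \<ge> 0" for y :: real
  proof -
    have "0\<^sup>2 / 2 - ln (cosh 0) \<le> y\<^sup>2 / 2 - ln (cosh y)"
    proof (rule DERIV_nonneg_imp_nondecreasing[OF that, of "\<lambda>x. x\<^sup>2 / 2 - ln (cosh x)"])
      fix x :: real assume "0 \<le> x"
      have "((\<lambda>x. x\<^sup>2 / 2 - ln (cosh x)) has_real_derivative x - tanh x) (at x)"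
        by (auto intro!: derivative_eq_intros simp: cosh_real_pos tanh_def field_simps)
      then show "\<exists>d. ((\<lambda>x. x\<^sup>2 / 2 - ln (cosh x)) has_real_derivative d) (at x) \<and> 0 \<le> d"
        using tanh_le[OF \<open>0 \<le> x\<close>] by (metis diff_ge_0_iff_ge)
    qed
    then have "ln (cosh y) \<le> y\<^sup>2 / 2" by simp
    then show ?thesis
      by (metis cosh_real_pos exp_le_cancel_iff exp_ln)
  qed
  show ?thesis
    using main[of x] main[of "-x"] by (cases "x \<ge> 0") auto
qed

text \<open>Quantifies that \<open>ln (cosh x)\<close> has second derivative at most 1: it misses
  midpoint concavity by at most (p - q)^2 / 4, an amount that a Gaussian weight can
  compensate.\<close>

lemma cosh_mult_cosh_le: "cosh p * cosh q \<le> (cosh ((p + q) / 2))\<^sup>2 * exp ((p - q)\<^sup>2 / 4)" for p q :: real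
proof -
  let ?e = "exp ((p - q)\<^sup>2 / 4)"
  have half: "2 * (cosh (x / 2))\<^sup>2 = cosh x + 1" for x :: real
    using cosh_double_cosh[of "x / 2"] by simp
  have "cosh ((p - q) / 2) \<le> exp (((p - q) / 2)\<^sup>2 / 2)"
    by (rule cosh_le_exp_half_square)
  then have "(cosh ((p - q) / 2))\<^sup>2 \<le> (exp (((p - q) / 2)\<^sup>2 / 2))\<^sup>2"
    by (intro power_mono) (auto simp: cosh_real_nonneg)
  also have "\<dots> = ?e"
    by (simp add: power2_eq_square flip: exp_add)
  finally have 1: "cosh (p - q) + 1 \<le> 2 * ?e" using half[of "p - q"] by simp
  have "(cosh (p + q) - 1) * 1 \<le> (cosh (p + q) - 1) * ?e"
    by (intro mult_left_mono) (auto simp: cosh_real_ge_1)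
  then have "cosh (p + q) + cosh (p - q) \<le> (cosh (p + q) + 1) * ?e"
    using 1 by (simp add: algebra_simps)
  moreover have "2 * (cosh p * cosh q) = cosh (p + q) + cosh (p - q)"
    by (simp add: cosh_add cosh_diff)
  moreover have "(cosh (p + q) + 1) * ?e = 2 * ((cosh ((p + q) / 2))\<^sup>2 * ?e)"
    using half[of "p + q"] by simp
  ultimately show ?thesis by linarith
qed

section \<open>Sums over spin configurations\<close>

lemma configs_0: "configs 0 = {\<lambda>_. 0}"
  by (auto simp: configs_def)

lemma configs_Suc: "configs (Suc N) = (\<lambda>\<sigma>. \<sigma>(N := 1)) ` configs N \<union> (\<lambda>\<sigma>. \<sigma>(N := -1)) ` configs N"
proof (intro equalityI subsetI)
  fix \<sigma> assume \<sigma>: "\<sigma> \<in> configs (Suc N)"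
  have "\<sigma>(N := 0) \<in> configs N" "\<sigma> N = 1 \<or> \<sigma> N = -1"
    using \<sigma> by (auto simp: configs_def less_Suc_eq)
  then show "\<sigma> \<in> (\<lambda>\<sigma>. \<sigma>(N := 1)) ` configs N \<union> (\<lambda>\<sigma>. \<sigma>(N := -1)) ` configs N"
    by (auto simp: image_iff intro!: bexI[of _ "\<sigma>(N := 0)"])
qed (auto simp: configs_def less_Suc_eq)

lemma finite_configs [simp]: "finite (configs N)"
  by (induction N) (auto simp: configs_0 configs_Suc)

lemma configs_nonempty [simp]: "configs N \<noteq> {}"
  by (induction N) (auto simp: configs_0 configs_Suc)

lemma sum_configs_prod:
  "(\<Sum>\<sigma>\<in>configs N. \<Prod>i<N. f i (\<sigma> i)) = (\<Prod>i<N. f i 1 + f i (-1))" for f :: "nat \<Rightarrow> real \<Rightarrow> real"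
proof (induction N)
  case 0 show ?case by (simp add: configs_0)
next
  case (Suc N)
  have inj: "inj_on (\<lambda>\<sigma>. \<sigma>(N := c)) (configs N)" for c :: real
  proof (rule inj_onI)
    fix \<sigma> \<tau> assume "\<sigma> \<in> configs N" "\<tau> \<in> configs N" and eq: "\<sigma>(N := c) = \<tau>(N := c)"
    \<comment> \<open>Both configurations are 0 at site \<open>N\<close>, so overwriting that site
      loses no information.\<close>
    then have "\<sigma> N = \<tau> N" by (simp add: configs_def)
    then show "\<sigma> = \<tau>" using eq by (metis fun_upd_triv fun_upd_upd)
  qed
  have part: "(\<Sum>\<sigma>\<in>(\<lambda>\<sigma>. \<sigma>(N := c)) ` configs N. \<Prod>i<Suc N. f i (\<sigma> i))
      = f N c * (\<Prod>i<N. f i 1 + f i (-1))" for c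
    by (simp add: sum.reindex[OF inj] Suc.IH[symmetric] sum_distrib_left mult.commute)
  have "(\<lambda>\<sigma>. \<sigma>(N := 1)) ` configs N \<inter> (\<lambda>\<sigma>. \<sigma>(N := -1)) ` configs N = {}"
    by (auto simp: fun_eq_iff) (metis one_neq_neg_one)
  then show ?case
    unfolding configs_Suc by (subst sum.union_disjoint) (auto simp only: finite_configs finite_imageI part, simp add: algebra_simps)
qed

lemma sum_configs_exp:
  "(\<Sum>\<sigma>\<in>configs N. exp (\<Sum>i<N. c i * \<sigma> i)) = (\<Prod>i<N. 2 * cosh (c i))" for c :: "nat \<Rightarrow> real"
proof -
  have "2 * cosh x = exp x + exp (- x)" for x :: real by (simp add: cosh_field_def)
  then show ?thesis
    using sum_configs_prod[of "\<lambda>i x. exp (c i * x)" N] by (simp add: exp_sum)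
qed

text \<open>A matrix and its transpose have the same operator norm. With y = A^T x and z = A y,
  |y|^2 is the inner product of x and z, hence at most |x|^2 / 4 + |z|^2 \<le> |x|^2 / 4 + |y|^2 /
  2, and the last term is absorbed on the left.\<close>

lemma transpose_form_bound:
  fixes A :: "nat \<Rightarrow> nat \<Rightarrow> real"
  assumes "\<And>y. (\<Sum>j<n. (\<Sum>i<N. A j i * y i)\<^sup>2) \<le> (\<Sum>i<N. (y i)\<^sup>2) / 2"
  shows "2 * (\<Sum>i<N. (\<Sum>j<n. A j i * x j)\<^sup>2) \<le> (\<Sum>j<n. (x j)\<^sup>2)"
proof -
  define y where "y i = (\<Sum>j<n. A j i * x j)" for i
  define z where "z j = (\<Sum>i<N. A j i * y i)" for j
  have "(\<Sum>i<N. (y i)\<^sup>2) = (\<Sum>i<N. \<Sum>j<n. y i * A j i * x j)"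
    by (simp add: y_def[symmetric] power2_eq_square sum_distrib_left mult.assoc) (simp add: y_def sum_distrib_left mult.assoc)
  also have "\<dots> = (\<Sum>j<n. x j * z j)"
    by (subst sum.swap) (simp add: z_def sum_distrib_left mult_ac)
  also have "\<dots> \<le> (\<Sum>j<n. (x j)\<^sup>2 / 4 + (z j)\<^sup>2)"
  proof (intro sum_mono)
    fix j show "x j * z j \<le> (x j)\<^sup>2 / 4 + (z j)\<^sup>2"
      using sum_squares_bound[of "x j / 2" "z j"] by (simp add: power_divide)
  qed
  also have "\<dots> = (\<Sum>j<n. (x j)\<^sup>2) / 4 + (\<Sum>j<n. (z j)\<^sup>2)"
    by (simp add: sum.distrib sum_divide_distrib)
  also have "(\<Sum>j<n. (z j)\<^sup>2) \<le> (\<Sum>i<N. (y i)\<^sup>2) / 2"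
    unfolding z_def by (rule assms)
  finally show ?thesis unfolding y_def by simp
qed

text \<open>The Hubbard-Stratonovich integrand is a Gaussian weight times hyperbolic cosines of
  functions affine in (v, l). At midpoints the weight gains (l - r)^2 / 2 + |v - w|^2 / 4 in the
  exponent, which covers the total defect of the cosines; integrating out the coordinates preserves
  the inequality.\<close>

lemma ising_partition_midpoint:
  fixes A :: "nat \<Rightarrow> nat \<Rightarrow> real" and b t :: "nat \<Rightarrow> real"
  assumes A: "\<And>x. 2 * (\<Sum>i<N. (\<Sum>j<n. A j i * x j)\<^sup>2) \<le> (\<Sum>j<n. (x j)\<^sup>2)"
    and t: "(\<Sum>i<N. (t i)\<^sup>2) = 1"
  defines "Z \<equiv> \<lambda>l. \<Sum>\<sigma>\<in>configs N. exp ((\<Sum>j<n. (\<Sum>i<N. A j i * \<sigma> i)\<^sup>2 / 2) + (\<Sum>i<N. (b i + l * t i) * \<sigma> i))"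
  shows "Z l * Z r \<le> exp ((l - r)\<^sup>2 / 2) * (Z ((l + r) / 2))\<^sup>2"
proof -
  define a where "a j \<sigma> = (\<Sum>i<N. A j i * \<sigma> i)" for j and \<sigma> :: "nat \<Rightarrow> real"
  \<comment> \<open>The factor \<open>exp (- l\<^sup>2)\<close> supplies the concavity in the field
    variable; removing it at the end produces \<open>exp ((l - r)\<^sup>2 / 2)\<close>.\<close>
  define p where "p \<sigma> l = exp ((\<Sum>i<N. (b i + l * t i) * \<sigma> i) - l\<^sup>2)" for \<sigma> :: "nat \<Rightarrow> real" and l
  define c where "c v l i = b i + l * t i + (\<Sum>j<n. A j i * v j)" for v :: "nat \<Rightarrow> real" and l i
  have hs0: "hs_sum p a (configs N) n 0 v l
      = exp (- l\<^sup>2 - (\<Sum>j<n. (v j)\<^sup>2) / 2) * (\<Prod>i<N. 2 * cosh (c v l i))" for v l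
  proof -
    have "(\<Sum>i<N. (b i + l * t i) * \<sigma> i) - l\<^sup>2 + (\<Sum>j<n. v j * a j \<sigma> - (v j)\<^sup>2 / 2)
        = - l\<^sup>2 - (\<Sum>j<n. (v j)\<^sup>2) / 2 + (\<Sum>i<N. c v l i * \<sigma> i)" for \<sigma>
    proof -
      have "(\<Sum>j<n. v j * a j \<sigma>) = (\<Sum>i<N. (\<Sum>j<n. A j i * v j) * \<sigma> i)"
        unfolding a_def sum_distrib_left sum_distrib_right by (subst sum.swap) (simp add: mult_ac)
      then show ?thesis
        by (simp add: c_def sum_subtractf sum_divide_distrib algebra_simps sum.distrib)
    qed
    then have "hs_sum p a (configs N) n 0 v l
        = (\<Sum>\<sigma>\<in>configs N. exp (- l\<^sup>2 - (\<Sum>j<n. (v j)\<^sup>2) / 2 + (\<Sum>i<N. c v l i * \<sigma> i)))"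
      by (simp only: hs_sum_def p_def lessThan_0 sum.empty add_0 atLeast0LessThan flip: exp_add)
    then show ?thesis
      by (simp only: exp_add sum_configs_exp flip: sum_distrib_left)
  qed
  have mid0: "hs_sum p a (configs N) n 0 v l * hs_sum p a (configs N) n 0 w r
        \<le> (hs_sum p a (configs N) n 0 (\<lambda>j. (v j + w j) / 2) ((l + r) / 2))\<^sup>2" for v w l r
  proof -
    define u where "u = (\<lambda>j. (v j + w j) / 2)"
    define e where "e = (l + r) / 2"
    have c_mid: "c u e i = (c v l i + c w r i) / 2" for i
    proof -
      have "(\<Sum>j<n. A j i * u j) = ((\<Sum>j<n. A j i * v j) + (\<Sum>j<n. A j i * w j)) / 2"
        unfolding sum.distrib[symmetric] sum_divide_distrib
        by (rule sum.cong) (auto simp: u_def field_simps)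
      then show ?thesis by (simp add: c_def e_def field_simps)
    qed
    have c_diff: "c v l i - c w r i = (l - r) * t i + (\<Sum>j<n. A j i * (v j - w j))" for i
      by (simp add: c_def sum_subtractf algebra_simps)
    \<comment> \<open>Splitting the square of a sum costs a factor 2, which is why \<open>A\<close>
      bounds twice the form; division by 4 then matches the Gaussian gain exactly.\<close>
    have "(\<Sum>i<N. (c v l i - c w r i)\<^sup>2)
        \<le> (\<Sum>i<N. 2 * ((l - r)\<^sup>2 * (t i)\<^sup>2) + 2 * (\<Sum>j<n. A j i * (v j - w j))\<^sup>2)"
    proof (intro sum_mono)
      fix i
      show "(c v l i - c w r i)\<^sup>2 \<le> 2 * ((l - r)\<^sup>2 * (t i)\<^sup>2) + 2 * (\<Sum>j<n. A j i * (v j - w j))\<^sup>2"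
        using sum_squares_bound[of "(l - r) * t i" "\<Sum>j<n. A j i * (v j - w j)"]
        unfolding c_diff power2_sum power_mult_distrib by linarith
    qed
    also have "\<dots> = 2 * (l - r)\<^sup>2 + 2 * (\<Sum>i<N. (\<Sum>j<n. A j i * (v j - w j))\<^sup>2)"
      by (simp add: sum.distrib t flip: sum_distrib_left)
    also have "\<dots> \<le> 2 * (l - r)\<^sup>2 + (\<Sum>j<n. (v j - w j)\<^sup>2)"
      using A[of "\<lambda>j. v j - w j"] by simp
    finally have sq: "(\<Sum>i<N. (c v l i - c w r i)\<^sup>2) / 4 \<le> (l - r)\<^sup>2 / 2 + (\<Sum>j<n. (v j - w j)\<^sup>2) / 4"
      by simp
    have vw: "(\<Sum>j<n. (v j - w j)\<^sup>2) / 4 = (\<Sum>j<n. (v j)\<^sup>2) / 2 + (\<Sum>j<n. (w j)\<^sup>2) / 2 - (\<Sum>j<n. (u j)\<^sup>2)"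
      by (simp add: sum_divide_distrib flip: sum.distrib sum_subtractf)
        (rule sum.cong, auto simp: u_def power2_eq_square field_simps)
    have lr: "(l - r)\<^sup>2 / 2 = l\<^sup>2 + r\<^sup>2 - 2 * e\<^sup>2"
      by (simp add: e_def power2_eq_square field_simps)
    have "(\<Prod>i<N. 2 * cosh (c v l i)) * (\<Prod>i<N. 2 * cosh (c w r i))
        \<le> (\<Prod>i<N. (2 * cosh (c u e i))\<^sup>2 * exp ((c v l i - c w r i)\<^sup>2 / 4))"
      unfolding prod.distrib[symmetric]
    proof (intro prod_mono conjI)
      fix i
      show "2 * cosh (c v l i) * (2 * cosh (c w r i)) \<le> (2 * cosh (c u e i))\<^sup>2 * exp ((c v l i - c w r i)\<^sup>2 / 4)"
        using cosh_mult_cosh_le[of "c v l i" "c w r i"] by (simp add: c_mid power_mult_distrib)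
    qed (simp add: cosh_real_nonneg)
    also have "\<dots> = (\<Prod>i<N. 2 * cosh (c u e i))\<^sup>2 * exp ((\<Sum>i<N. (c v l i - c w r i)\<^sup>2) / 4)"
      by (simp only: prod.distrib[of "\<lambda>i. (2 * cosh (c u e i))\<^sup>2"] prod_power_distrib exp_sum
        sum_divide_distrib finite_lessThan)
    also have "\<dots> \<le> (\<Prod>i<N. 2 * cosh (c u e i))\<^sup>2 * exp ((l - r)\<^sup>2 / 2 + (\<Sum>j<n. (v j - w j)\<^sup>2) / 4)"
      using sq by (intro mult_left_mono) auto
    finally have *: "(\<Prod>i<N. 2 * cosh (c v l i)) * (\<Prod>i<N. 2 * cosh (c w r i)) \<le> \<dots>" .
    have "hs_sum p a (configs N) n 0 v l * hs_sum p a (configs N) n 0 w r =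
       exp (- l\<^sup>2 - (\<Sum>j<n. (v j)\<^sup>2) / 2) * exp (- r\<^sup>2 - (\<Sum>j<n. (w j)\<^sup>2) / 2)
        * ((\<Prod>i<N. 2 * cosh (c v l i)) * (\<Prod>i<N. 2 * cosh (c w r i)))"
      by (simp add: hs0)
    also have "\<dots> \<le> exp (- l\<^sup>2 - (\<Sum>j<n. (v j)\<^sup>2) / 2) * exp (- r\<^sup>2 - (\<Sum>j<n. (w j)\<^sup>2) / 2)
        * ((\<Prod>i<N. 2 * cosh (c u e i))\<^sup>2 * exp ((l - r)\<^sup>2 / 2 + (\<Sum>j<n. (v j - w j)\<^sup>2) / 4))"
      by (intro mult_left_mono *) auto
    also have "\<dots> = (exp (- e\<^sup>2 - (\<Sum>j<n. (u j)\<^sup>2) / 2))\<^sup>2 * (\<Prod>i<N. 2 * cosh (c u e i))\<^sup>2"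
    proof -
      have "exp (- l\<^sup>2 - (\<Sum>j<n. (v j)\<^sup>2) / 2) * exp (- r\<^sup>2 - (\<Sum>j<n. (w j)\<^sup>2) / 2)
        * exp ((l - r)\<^sup>2 / 2 + (\<Sum>j<n. (v j - w j)\<^sup>2) / 4) = (exp (- e\<^sup>2 - (\<Sum>j<n. (u j)\<^sup>2) / 2))\<^sup>2"
        unfolding vw lr by (simp add: power2_eq_square[of "exp _"] flip: exp_add)
      then show ?thesis by (simp only: mult_ac)
    qed
    also have "\<dots> = (hs_sum p a (configs N) n 0 u e)\<^sup>2"
      by (simp only: hs0 power_mult_distrib)
    finally show ?thesis unfolding u_def e_def .
  qed
  \<comment> \<open>At stage \<open>n\<close> every coordinate has been integrated out, so the value
    no longer depends on \<open>v\<close>.\<close>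
  have hsn: "hs_sum p a (configs N) n n v l = exp (- l\<^sup>2) * Z l" for v l
    by (simp add: hs_sum_def p_def Z_def a_def sum_distrib_left exp_diff exp_minus exp_add field_simps)
  have "hs_sum p a (configs N) n n (\<lambda>_. 0) l * hs_sum p a (configs N) n n (\<lambda>_. 0) r
      \<le> (hs_sum p a (configs N) n n (\<lambda>j. (0 + 0) / 2) ((l + r) / 2))\<^sup>2"
    by (rule hs_sum_midpoint[OF _ _ _ mid0]) (auto simp: p_def)
  then have hs: "(exp (- l\<^sup>2) * Z l) * (exp (- r\<^sup>2) * Z r) \<le> (exp (- ((l + r) / 2)\<^sup>2) * Z ((l + r) / 2))\<^sup>2"
    unfolding hsn .
  have "Z l * Z r = exp (l\<^sup>2 + r\<^sup>2) * ((exp (- l\<^sup>2) * Z l) * (exp (- r\<^sup>2) * Z r))"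
    by (simp add: exp_add exp_minus field_simps)
  also have "\<dots> \<le> exp (l\<^sup>2 + r\<^sup>2) * (exp (- ((l + r) / 2)\<^sup>2) * Z ((l + r) / 2))\<^sup>2"
    by (intro mult_left_mono hs) simp
  also have "\<dots> = exp (l\<^sup>2 + r\<^sup>2) * (exp (- ((l + r) / 2)\<^sup>2))\<^sup>2 * (Z ((l + r) / 2))\<^sup>2"
    by (simp only: power_mult_distrib mult.assoc)
  also have "exp (l\<^sup>2 + r\<^sup>2) * (exp (- ((l + r) / 2)\<^sup>2))\<^sup>2 = exp ((l - r)\<^sup>2 / 2)"
    unfolding power2_eq_square[of "exp _"] exp_add[symmetric]
    by (simp add: power2_eq_square field_simps)
  finally show ?thesis .
qed

text \<open>Completing the square in the last variable leaves the Schur complement \<open>J'\<close>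
  on the others. It keeps the constant \<open>c\<close>: with the last variable chosen to annihilate
  the square, it equals the old form at a vector of no smaller norm.\<close>

lemma cholesky_decomposition:
  fixes J :: "nat \<Rightarrow> nat \<Rightarrow> real"
  assumes c: "c > 0" and sym: "\<And>i j. J i j = J j i"
    and pd: "\<And>x. c * (\<Sum>i<n. (x i)\<^sup>2) \<le> (\<Sum>i<n. \<Sum>j<n. J i j * x i * x j)"
  shows "\<exists>A. \<forall>x. (\<Sum>i<n. \<Sum>j<n. J i j * x i * x j) = (\<Sum>m<n. (\<Sum>i<n. A m i * x i)\<^sup>2)"
  using sym pd
proof (induction n arbitrary: J)
  case 0 show ?case by simp
next
  case (Suc n)
  define d where "d = J n n"
  have split: "(\<Sum>i<Suc n. \<Sum>j<Suc n. J i j * x i * x j)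
     = (\<Sum>i<n. \<Sum>j<n. J i j * x i * x j) + 2 * x n * (\<Sum>i<n. J i n * x i) + d * (x n)\<^sup>2" for x
    using Suc.prems(1) by (simp add: sum.distrib d_def power2_eq_square sum_distrib_left algebra_simps)
  have "c * 1 \<le> d"
    using Suc.prems(2)[of "\<lambda>i. if i = n then 1 else 0"] unfolding split by simp
  then have d: "d > 0" using c by simp
  define J' where "J' i j = J i j - J i n * J j n / d" for i j
  have J'_form: "(\<Sum>i<n. \<Sum>j<n. J' i j * x i * x j)
      = (\<Sum>i<n. \<Sum>j<n. J i j * x i * x j) - (\<Sum>i<n. J i n * x i)\<^sup>2 / d" for x
    by (simp add: J'_def power2_eq_square sum_product sum_divide_distrib algebra_simps flip: sum_subtractf)
  have square: "(\<Sum>i<Suc n. \<Sum>j<Suc n. J i j * x i * x j)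
     = (\<Sum>i<n. \<Sum>j<n. J' i j * x i * x j) + d * (x n + (\<Sum>i<n. J i n * x i) / d)\<^sup>2" for x
    unfolding split J'_form using d by (simp add: power2_eq_square field_simps)
  have "\<exists>A. \<forall>x. (\<Sum>i<n. \<Sum>j<n. J' i j * x i * x j) = (\<Sum>m<n. (\<Sum>i<n. A m i * x i)\<^sup>2)"
  proof (rule Suc.IH)
    show "J' i j = J' j i" for i j using Suc.prems(1) by (simp add: J'_def mult.commute)
    fix x :: "nat \<Rightarrow> real"
    define y where "y = x(n := - (\<Sum>i<n. J i n * x i) / d)"
    have "c * (\<Sum>i<n. (x i)\<^sup>2) \<le> c * (\<Sum>i<Suc n. (y i)\<^sup>2)"
      using c by (intro mult_left_mono) (auto simp: y_def)
    also have "\<dots> \<le> (\<Sum>i<Suc n. \<Sum>j<Suc n. J i j * y i * y j)"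
      by (rule Suc.prems(2))
    also have "\<dots> = (\<Sum>i<n. \<Sum>j<n. J' i j * x i * x j)"
      unfolding square by (simp add: y_def)
    finally show "c * (\<Sum>i<n. (x i)\<^sup>2) \<le> (\<Sum>i<n. \<Sum>j<n. J' i j * x i * x j)" .
  qed
  then obtain A where A: "\<And>x. (\<Sum>i<n. \<Sum>j<n. J' i j * x i * x j) = (\<Sum>m<n. (\<Sum>i<n. A m i * x i)\<^sup>2)"
    by blast
  define B where "B m i = (if m < n then if i < n then A m i else 0
     else sqrt d * (if i < n then J i n / d else 1))" for m i
  have "(\<Sum>i<Suc n. \<Sum>j<Suc n. J i j * x i * x j) = (\<Sum>m<Suc n. (\<Sum>i<Suc n. B m i * x i)\<^sup>2)" for x
  proof -
    have "(\<Sum>i<Suc n. B n i * x i) = sqrt d * (x n + (\<Sum>i<n. J i n * x i) / d)"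
      by (simp add: B_def sum_distrib_left sum_divide_distrib algebra_simps)
    then have "(\<Sum>i<Suc n. B n i * x i)\<^sup>2 = d * (x n + (\<Sum>i<n. J i n * x i) / d)\<^sup>2"
      using d by (simp only: power_mult_distrib) simp
    moreover have "(\<Sum>i<Suc n. B m i * x i) = (\<Sum>i<n. A m i * x i)" if "m < n" for m
      using that by (simp add: B_def)
    ultimately show ?thesis unfolding square A by simp
  qed
  then show ?case by blast
qed

section \<open>Moments for good disorder\<close>

lemma power_le_fact_exp: "x ^ n \<le> fact n * exp x" if "x \<ge> 0" for x :: real
proof -
  have "x ^ n /\<^sub>R fact n \<le> (\<Sum>n. x ^ n /\<^sub>R fact n)"
    using sum_le_suminf[OF summable_exp_generic[of x], of "{n}"] that by simp
  then show ?thesis by (simp add: exp_def field_simps)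
qed

section \<open>The symmetric coupling form and its relation to the Hamiltonian\<close>

definition coupling :: "(nat \<times> nat \<Rightarrow> real) \<Rightarrow> nat \<Rightarrow> nat \<Rightarrow> real" where
  "coupling g i j = (if i < j then g (i, j) else if j < i then g (j, i) else 0)"

definition coupling_form :: "nat \<Rightarrow> (nat \<times> nat \<Rightarrow> real) \<Rightarrow> (nat \<Rightarrow> real) \<Rightarrow> real" where
  "coupling_form N g x = (\<Sum>i<N. \<Sum>j<N. coupling g i j * x i * x j)"

lemma coupling_form_eq_pairs:
  "coupling_form N g x = 2 * (\<Sum>i<N. \<Sum>j\<in>{i<..<N}. g (i, j) * x i * x j)"
proof -
  have "(\<Sum>j<N. coupling g i j * x i * x j)
      = (\<Sum>j\<in>{i<..<N}. g (i, j) * x i * x j) + (\<Sum>j<i. g (j, i) * x j * x i)" if "i < N" for i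
  proof -
    have split: "{..<N} = {..<i} \<union> ({i} \<union> {i<..<N})" using that by auto
    have "(\<Sum>j<N. coupling g i j * x i * x j) = (\<Sum>j<i. coupling g i j * x i * x j)
        + ((\<Sum>j\<in>{i}. coupling g i j * x i * x j) + (\<Sum>j\<in>{i<..<N}. coupling g i j * x i * x j))"
      unfolding split by (subst sum.union_disjoint; auto)
    then show ?thesis by (simp add: coupling_def mult_ac)
  qed
  then have "coupling_form N g x = (\<Sum>i<N. \<Sum>j\<in>{i<..<N}. g (i, j) * x i * x j)
      + (\<Sum>i<N. \<Sum>j<i. g (j, i) * x j * x i)"
    by (simp add: coupling_form_def sum.distrib)
  also have "(\<Sum>i<N. \<Sum>j<i. g (j, i) * x j * x i) = (\<Sum>j<N. \<Sum>i\<in>{j<..<N}. g (j, i) * x j * x i)"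
    by (simp add: sum.Sigma) (rule sum.reindex_bij_witness[of _ prod.swap prod.swap]; auto)
  finally show ?thesis by simp
qed

text \<open>Displays the form as linear in the disorder, so that it is Gaussian for fixed
  \<open>x\<close>.\<close>

lemma coupling_form_pairs: "coupling_form N g x = (\<Sum>p\<in>pairs N. 2 * x (fst p) * x (snd p) * g p)"
proof -
  have "pairs N = Sigma {..<N} (\<lambda>i. {i<..<N})" by (auto simp: pairs_def)
  then show ?thesis
    unfolding coupling_form_eq_pairs sum_distrib_left
    by (simp add: sum.Sigma case_prod_beta mult_ac)
qed

lemma sum_square_configs: "\<sigma> \<in> configs N \<Longrightarrow> (\<Sum>i<N. (\<sigma> i)\<^sup>2) = real N"
proof -
  assume "\<sigma> \<in> configs N"
  then have "(\<Sum>i<N. (\<sigma> i)\<^sup>2) = (\<Sum>i<N. 1)"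
    by (intro sum.cong) (auto simp: configs_def)
  then show ?thesis by simp
qed

lemma tilted_partition_bound:
  fixes h :: real
  assumes N: "1 \<le> N" and t: "(\<Sum>i<N. (t i)\<^sup>2) = 1" and \<beta>: "0 < \<beta>" "\<beta> * K \<le> 1 / 6"
    and bound: "\<And>x. \<bar>coupling_form N g x\<bar> \<le> K * sqrt (real N) * (\<Sum>i<N. (x i)\<^sup>2)"
  defines "W \<equiv> \<lambda>l. \<Sum>\<sigma>\<in>configs N. exp (minusH N \<beta> h g \<sigma> + l * (\<Sum>i<N. t i * \<sigma> i))"
  shows "W l * W (- l) \<le> exp (2 * l\<^sup>2) * (Zpart N \<beta> h g)\<^sup>2"
proof -
  \<comment> \<open>The scaled coupling has spectrum in [-1/6, 1/6]; adding 1/3 moves it to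
    [1/6, 1/2]. The lower end permits Cholesky, the upper end feeds
    \<open>transpose_form_bound\<close>.\<close>
  define J where "J i j = \<beta> / sqrt N * coupling g i j + (if i = j then 1 / 3 else 0)" for i j
  have J_form: "(\<Sum>i<N. \<Sum>j<N. J i j * x i * x j)
      = \<beta> / sqrt N * coupling_form N g x + (\<Sum>i<N. (x i)\<^sup>2) / 3" for x
  proof -
    have "J i j * x i * x j = \<beta> / sqrt N * (coupling g i j * x i * x j) + (if j = i then (x i)\<^sup>2 / 3 else 0)" for i j
      by (simp add: J_def power2_eq_square algebra_simps)
    then show ?thesis
      by (simp add: coupling_form_def sum.distrib sum_distrib_left sum_divide_distrib)
  qed
  have small: "\<bar>\<beta> / sqrt N * coupling_form N g x\<bar> \<le> (\<Sum>i<N. (x i)\<^sup>2) / 6" for x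
  proof -
    have "\<bar>\<beta> / sqrt N * coupling_form N g x\<bar> = \<beta> / sqrt N * \<bar>coupling_form N g x\<bar>"
      using \<beta> by (simp add: abs_mult)
    also have "\<dots> \<le> \<beta> / sqrt N * (K * sqrt (real N) * (\<Sum>i<N. (x i)\<^sup>2))"
      using \<beta> by (intro mult_left_mono bound) auto
    also have "\<dots> = \<beta> * K * (\<Sum>i<N. (x i)\<^sup>2)" using N by simp
    also have "\<dots> \<le> 1 / 6 * (\<Sum>i<N. (x i)\<^sup>2)"
      by (intro mult_right_mono \<beta> sum_nonneg) auto
    finally show ?thesis by simp
  qed
  have "\<exists>A. \<forall>x. (\<Sum>i<N. \<Sum>j<N. J i j * x i * x j) = (\<Sum>m<N. (\<Sum>i<N. A m i * x i)\<^sup>2)"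
  proof (rule cholesky_decomposition[of "1 / 6"])
    show "J i j = J j i" for i j by (simp add: J_def coupling_def)
    show "1 / 6 * (\<Sum>i<N. (x i)\<^sup>2) \<le> (\<Sum>i<N. \<Sum>j<N. J i j * x i * x j)" for x
      using small[of x] unfolding J_form by linarith
  qed simp
  then obtain A where A: "\<And>x. (\<Sum>i<N. \<Sum>j<N. J i j * x i * x j) = (\<Sum>m<N. (\<Sum>i<N. A m i * x i)\<^sup>2)"
    by blast
  have "(\<Sum>m<N. (\<Sum>i<N. A m i * x i)\<^sup>2) \<le> (\<Sum>i<N. (x i)\<^sup>2) / 2" for x
    using small[of x] unfolding A[symmetric] J_form by linarith
  then have A_transpose: "2 * (\<Sum>i<N. (\<Sum>j<N. A j i * x j)\<^sup>2) \<le> (\<Sum>j<N. (x j)\<^sup>2)" for x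
    by (rule transpose_form_bound)
  define Z where "Z l = (\<Sum>\<sigma>\<in>configs N. exp ((\<Sum>j<N. (\<Sum>i<N. A j i * \<sigma> i)\<^sup>2 / 2) + (\<Sum>i<N. (h + l * t i) * \<sigma> i)))" for l
  \<comment> \<open>On configurations the added identity contributes half of \<open>N / 3\<close> to
    the exponent, a constant factor that cancels from both sides.\<close>
  have Z_W: "Z l = exp (real N / 6) * W l" for l
  proof -
    have "(\<Sum>j<N. (\<Sum>i<N. A j i * \<sigma> i)\<^sup>2 / 2) + (\<Sum>i<N. (h + l * t i) * \<sigma> i)
        = real N / 6 + (minusH N \<beta> h g \<sigma> + l * (\<Sum>i<N. t i * \<sigma> i))" if "\<sigma> \<in> configs N" for \<sigma>
    proof -
      have "(\<Sum>j<N. (\<Sum>i<N. A j i * \<sigma> i)\<^sup>2 / 2) = (\<beta> / sqrt N * coupling_form N g \<sigma> + real N / 3) / 2"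
        using A[of \<sigma>] J_form[of \<sigma>] sum_square_configs[OF that] by (simp flip: sum_divide_distrib)
      moreover have "(\<Sum>i<N. (h + l * t i) * \<sigma> i) = h * (\<Sum>i<N. \<sigma> i) + l * (\<Sum>i<N. t i * \<sigma> i)"
        by (simp add: algebra_simps sum.distrib sum_distrib_left)
      ultimately show ?thesis
        unfolding minusH_def coupling_form_eq_pairs by (simp add: field_simps)
    qed
    then show ?thesis by (simp add: Z_def W_def sum_distrib_left flip: exp_add)
  qed
  \<comment> \<open>Opposite fields have midpoint 0 and difference \<open>2 * l\<close>.\<close>
  have "Z l * Z (- l) \<le> exp (2 * l\<^sup>2) * (Z 0)\<^sup>2"
    using ising_partition_midpoint[OF A_transpose t, of "\<lambda>_. h" l "- l"]
    by (simp add: Z_def power_mult_distrib)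
  then have "(exp (real N / 6))\<^sup>2 * (W l * W (- l)) \<le> (exp (real N / 6))\<^sup>2 * (exp (2 * l\<^sup>2) * (W 0)\<^sup>2)"
    unfolding Z_W by (simp add: power2_eq_square mult_ac)
  then have "W l * W (- l) \<le> exp (2 * l\<^sup>2) * (W 0)\<^sup>2" by simp
  then show ?thesis by (simp add: W_def Zpart_def)
qed

lemma Zpart_pos: "Zpart N \<beta> h g > 0"
  unfolding Zpart_def by (intro sum_pos) auto

lemma gibbs2_le:
  assumes "\<And>\<sigma>1 \<sigma>2. \<sigma>1 \<in> configs N \<Longrightarrow> \<sigma>2 \<in> configs N \<Longrightarrow> f \<sigma>1 \<sigma>2 \<le> c"
  shows "gibbs2 N \<beta> h g f \<le> c"
proof -
  have "(\<Sum>\<sigma>1\<in>configs N. \<Sum>\<sigma>2\<in>configs N. f \<sigma>1 \<sigma>2 * exp (minusH N \<beta> h g \<sigma>1) * exp (minusH N \<beta> h g \<sigma>2))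
      \<le> (\<Sum>\<sigma>1\<in>configs N. \<Sum>\<sigma>2\<in>configs N. c * exp (minusH N \<beta> h g \<sigma>1) * exp (minusH N \<beta> h g \<sigma>2))"
    by (intro sum_mono mult_right_mono assms) auto
  also have "\<dots> = c * (Zpart N \<beta> h g)\<^sup>2"
    unfolding Zpart_def power2_eq_square sum_product by (simp only: sum_distrib_left mult.assoc)
  finally show ?thesis
    unfolding gibbs2_def using Zpart_pos[of N \<beta> h g] by (simp add: divide_le_eq)
qed

text \<open>The bound on \<open>W l * W (- l)\<close> is a sub-Gaussian exponential moment of the
  replica difference; a single term of the exponential series converts it into a power
  moment.\<close>

lemma gibbs2_moment_good_disorder:
  assumes N: "1 \<le> N" and t: "(\<Sum>i<N. (t i)\<^sup>2) = 1" and \<beta>: "0 < \<beta>" "\<beta> * K \<le> 1 / 6" and k: "1 \<le> k"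
    and bound: "\<And>x. \<bar>coupling_form N g x\<bar> \<le> K * sqrt (real N) * (\<Sum>i<N. (x i)\<^sup>2)"
  shows "gibbs2 N \<beta> h g (\<lambda>\<sigma>1 \<sigma>2. (\<Sum>i<N. t i * (\<sigma>1 i - \<sigma>2 i)) ^ (2 * k)) \<le> (8 * exp 2 * real k) ^ k"
proof -
  define X where "X \<sigma>1 \<sigma>2 = (\<Sum>i<N. t i * (\<sigma>1 i - \<sigma>2 i))" for \<sigma>1 \<sigma>2 :: "nat \<Rightarrow> real"
  define w where "w \<sigma> = exp (minusH N \<beta> h g \<sigma>)" for \<sigma>
  define T where "T \<sigma> = (\<Sum>i<N. t i * \<sigma> i)" for \<sigma> :: "nat \<Rightarrow> real"
  define W where "W l = (\<Sum>\<sigma>\<in>configs N. exp (minusH N \<beta> h g \<sigma> + l * T \<sigma>))" for l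
  have X: "X \<sigma>1 \<sigma>2 = T \<sigma>1 - T \<sigma>2" for \<sigma>1 \<sigma>2
    by (simp add: X_def T_def algebra_simps sum_subtractf)
  \<comment> \<open>The replicas decouple, the second one being tilted by
    \<open>- l\<close>.\<close>
  have exp_sum_W: "(\<Sum>\<sigma>1\<in>configs N. \<Sum>\<sigma>2\<in>configs N. exp (l * X \<sigma>1 \<sigma>2) * w \<sigma>1 * w \<sigma>2) = W l * W (- l)" for l
    unfolding W_def sum_product by (intro sum.cong refl) (simp add: X w_def algebra_simps flip: exp_add)
  \<comment> \<open>With this choice \<open>exp (2 * l\<^sup>2)\<close> is a constant to the power
    \<open>k\<close>, and \<open>l ^ (2 * k) = k ^ k\<close> cancels half of the growth of
    \<open>fact (2 * k)\<close>.\<close>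
  define l where "l = sqrt k"
  have l: "l > 0" "l\<^sup>2 = k" using k by (auto simp: l_def)
  have point: "real k ^ k * X \<sigma>1 \<sigma>2 ^ (2 * k) \<le> fact (2 * k) * (exp (l * X \<sigma>1 \<sigma>2) + exp (- l * X \<sigma>1 \<sigma>2))" for \<sigma>1 \<sigma>2
  proof -
    have "real k ^ k * X \<sigma>1 \<sigma>2 ^ (2 * k) = \<bar>l * X \<sigma>1 \<sigma>2\<bar> ^ (2 * k)"
      by (simp add: power_mult power_mult_distrib l abs_mult)
    also have "\<dots> \<le> fact (2 * k) * exp \<bar>l * X \<sigma>1 \<sigma>2\<bar>" by (rule power_le_fact_exp) simp
    also have "\<dots> \<le> fact (2 * k) * (exp (l * X \<sigma>1 \<sigma>2) + exp (- l * X \<sigma>1 \<sigma>2))"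
      by (intro mult_left_mono) (auto simp: abs_if)
    finally show ?thesis .
  qed
  let ?M = "\<Sum>\<sigma>1\<in>configs N. \<Sum>\<sigma>2\<in>configs N. X \<sigma>1 \<sigma>2 ^ (2 * k) * w \<sigma>1 * w \<sigma>2"
  have "real k ^ k * ?M = (\<Sum>\<sigma>1\<in>configs N. \<Sum>\<sigma>2\<in>configs N. (real k ^ k * X \<sigma>1 \<sigma>2 ^ (2 * k)) * w \<sigma>1 * w \<sigma>2)"
    by (simp add: sum_distrib_left mult.assoc)
  also have "\<dots> \<le> (\<Sum>\<sigma>1\<in>configs N. \<Sum>\<sigma>2\<in>configs N.
      (fact (2 * k) * (exp (l * X \<sigma>1 \<sigma>2) + exp (- l * X \<sigma>1 \<sigma>2))) * w \<sigma>1 * w \<sigma>2)"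
    by (intro sum_mono mult_right_mono point) (auto simp: w_def)
  also have "\<dots> = fact (2 * k) * ((\<Sum>\<sigma>1\<in>configs N. \<Sum>\<sigma>2\<in>configs N. exp (l * X \<sigma>1 \<sigma>2) * w \<sigma>1 * w \<sigma>2)
      + (\<Sum>\<sigma>1\<in>configs N. \<Sum>\<sigma>2\<in>configs N. exp (- l * X \<sigma>1 \<sigma>2) * w \<sigma>1 * w \<sigma>2))"
    by (simp add: sum_distrib_left ring_distribs sum.distrib mult.assoc)
  also have "\<dots> = 2 * fact (2 * k) * (W l * W (- l))"
    unfolding exp_sum_W by simp
  also have "\<dots> \<le> 2 * fact (2 * k) * (exp (2 * l\<^sup>2) * (Zpart N \<beta> h g)\<^sup>2)"
    unfolding W_def T_def
    by (intro mult_left_mono tilted_partition_bound[OF N t \<beta> bound]) auto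
  also have "\<dots> \<le> 2 * (real (2 * k) ^ (2 * k)) * (exp (2 * l\<^sup>2) * (Zpart N \<beta> h g)\<^sup>2)"
    using fact_le_power[of "2 * k", where 'a = real] by (intro mult_right_mono) auto
  also have "real (2 * k) ^ (2 * k) = real k ^ k * (4 * real k) ^ k"
    unfolding power_mult by (simp add: power2_eq_square power_mult_distrib)
  also have "exp (2 * l\<^sup>2) = exp 2 ^ k"
    unfolding l by (simp add: mult.commute flip: exp_of_nat_mult)
  finally have "real k ^ k * ?M \<le> real k ^ k * (2 * (4 * exp 2 * real k) ^ k * (Zpart N \<beta> h g)\<^sup>2)"
    by (simp add: power_mult_distrib mult_ac)
  then have "?M \<le> 2 * (4 * exp 2 * real k) ^ k * (Zpart N \<beta> h g)\<^sup>2"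
    using k by (simp add: mult_le_cancel_left_pos)
  also have "\<dots> \<le> (2 ^ k * (4 * exp 2 * real k) ^ k) * (Zpart N \<beta> h g)\<^sup>2"
    using power_increasing[OF k, of "2 :: real"] by (intro mult_right_mono) auto
  also have "2 ^ k * (4 * exp 2 * real k) ^ k = (8 * exp 2 * real k) ^ k"
    unfolding power_mult_distrib[symmetric] by (simp add: power_mult_distrib)
  finally show ?thesis
    unfolding gibbs2_def using Zpart_pos[of N \<beta> h g]
    by (simp add: divide_le_eq X_def w_def)
qed

text \<open>Cauchy-Schwarz: each coordinate of the replica difference is at most 2 in absolute
  value. This serves the exceptional disorder.\<close>

lemma gibbs2_moment_trivial:
  assumes t: "(\<Sum>i<N. (t i)\<^sup>2) = 1"
  shows "gibbs2 N \<beta> h g (\<lambda>\<sigma>1 \<sigma>2. (\<Sum>i<N. t i * (\<sigma>1 i - \<sigma>2 i)) ^ (2 * k)) \<le> (4 * real N) ^ k"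
proof (rule gibbs2_le)
  fix \<sigma>1 \<sigma>2 assume \<sigma>: "\<sigma>1 \<in> configs N" "\<sigma>2 \<in> configs N"
  have "(\<Sum>i<N. t i * (\<sigma>1 i - \<sigma>2 i))\<^sup>2 \<le> (\<Sum>i<N. (t i)\<^sup>2) * (\<Sum>i<N. (\<sigma>1 i - \<sigma>2 i)\<^sup>2)"
    by (rule Cauchy_Schwarz_ineq_sum)
  also have "\<dots> \<le> (\<Sum>i<N. 4)"
    unfolding t mult_1
  proof (intro sum_mono)
    fix i assume "i \<in> {..<N}"
    then have "\<sigma>1 i = - 1 \<or> \<sigma>1 i = 1" "\<sigma>2 i = - 1 \<or> \<sigma>2 i = 1"
      using \<sigma> by (auto simp: configs_def)
    then show "(\<sigma>1 i - \<sigma>2 i)\<^sup>2 \<le> 4" by (elim disjE) simp_all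
  qed
  finally show "(\<Sum>i<N. t i * (\<sigma>1 i - \<sigma>2 i)) ^ (2 * k) \<le> (4 * real N) ^ k"
    unfolding power_mult by (intro power_mono) auto
qed

section \<open>The operator norm of the disorder\<close>

text \<open>Integer points of the ball of radius \<open>8 * sqrt N\<close>. The box makes finiteness
  evident and is implied by the norm bound, since an integer is at most its square in absolute
  value.\<close>

definition net :: "nat \<Rightarrow> (nat \<Rightarrow> int) set" where
  "net N = {z \<in> PiE {..<N} (\<lambda>_. {-(64 * int N)..64 * int N}). (\<Sum>i<N. (real_of_int (z i))\<^sup>2) \<le> 64 * real N}"

text \<open>With this mesh a coordinatewise rounding error of one lattice step has norm at most
  1/8.\<close>

definition scaled :: "nat \<Rightarrow> (nat \<Rightarrow> int) \<Rightarrow> nat \<Rightarrow> real" where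
  "scaled N z i = real_of_int (z i) / (8 * sqrt (real N))"

lemma finite_net [simp]: "finite (net N)"
  unfolding net_def by (rule finite_subset[of _ "PiE {..<N} (\<lambda>_. {-(64 * int N)..64 * int N})"]) (auto intro: finite_PiE)

lemma sum_exp_minus_square_int: "(\<Sum>z\<in>{- int M..int M}. exp (- (real_of_int z)\<^sup>2)) \<le> 3"
proof -
  \<comment> \<open>Strengthened for the induction: z^2 \<ge> |z| and e \<ge> 2 compare the sum with
    1 plus two geometric series of ratio 1/2, whose partial sums give this bound.\<close>
  have "(\<Sum>z\<in>{- int M..int M}. exp (- (real_of_int z)\<^sup>2)) \<le> 3 - 2 / 2 ^ M"
  proof (induction M)
    case 0 show ?case by simp
  next
    case (Suc M)
    have eq: "{- int (Suc M)..int (Suc M)} = insert (- int (Suc M)) (insert (int (Suc M)) {- int M..int M})"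
      by auto
    have "exp (- (real (Suc M))\<^sup>2) \<le> exp (- real (Suc M))"
      using self_le_power[of "real (Suc M)" 2] by simp
    also have "\<dots> = exp (- 1) ^ Suc M"
      using exp_of_nat_mult[of "Suc M" "- 1 :: real"] by (simp only: mult_minus_right mult_1_right)
    also have "\<dots> \<le> (1 / 2) ^ Suc M"
      using exp_ge_add_one_self[of 1] by (intro power_mono) (auto simp: exp_minus field_simps)
    finally have "2 * exp (- (real (Suc M))\<^sup>2) \<le> 1 / 2 ^ M"
      by (simp add: power_one_over field_simps)
    moreover have "(\<Sum>z\<in>{- int (Suc M)..int (Suc M)}. exp (- (real_of_int z)\<^sup>2))
        = 2 * exp (- (real (Suc M))\<^sup>2) + (\<Sum>z\<in>{- int M..int M}. exp (- (real_of_int z)\<^sup>2))"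
      using power2_minus[of "1 + real M"] unfolding eq by (simp add: algebra_simps)
    ultimately show ?case using Suc.IH by (simp add: field_simps)
  qed
  also have "\<dots> \<le> 3" by simp
  finally show ?thesis .
qed

text \<open>On \<open>net N\<close> the Gaussian weight \<open>exp (64 * N - |z|\<^sup>2)\<close> is at least 1, and its total mass factorises.\<close>

lemma card_net: "real (card (net N)) \<le> exp (66 * real N)"
proof -
  let ?P = "PiE {..<N} (\<lambda>_. {-(64 * int N)..64 * int N})"
  have fin: "finite ?P" by (auto intro: finite_PiE)
  have three: "3 \<le> exp (2 :: real)" using exp_ge_add_one_self[of 2] by simp
  have "real (card (net N)) = (\<Sum>z\<in>net N. 1)" by simp
  also have "\<dots> \<le> (\<Sum>z\<in>net N. exp (64 * real N - (\<Sum>i<N. (real_of_int (z i))\<^sup>2)))"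
    by (intro sum_mono) (auto simp: net_def)
  also have "\<dots> \<le> (\<Sum>z\<in>?P. exp (64 * real N - (\<Sum>i<N. (real_of_int (z i))\<^sup>2)))"
    by (intro sum_mono2 fin) (auto simp: net_def)
  also have "\<dots> = exp (64 * real N) * (\<Sum>z\<in>?P. \<Prod>i<N. exp (- (real_of_int (z i))\<^sup>2))"
    by (simp add: exp_diff sum_distrib_left exp_sum exp_minus divide_inverse prod_inversef flip: prod_inversef)
  also have "(\<Sum>z\<in>?P. \<Prod>i<N. exp (- (real_of_int (z i))\<^sup>2))
      = (\<Prod>i<N. \<Sum>z\<in>{-(64 * int N)..64 * int N}. exp (- (real_of_int z)\<^sup>2))"
    by (rule prod_sum_PiE[symmetric]) auto
  also have "\<dots> \<le> (\<Prod>i<N. exp 2)"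
  proof (intro prod_mono conjI sum_nonneg)
    show "(\<Sum>z\<in>{-(64 * int N)..64 * int N}. exp (- (real_of_int z)\<^sup>2)) \<le> exp 2"
      using sum_exp_minus_square_int[of "64 * N"] three by simp
  qed auto
  also have "exp (64 * real N) * (\<Prod>i<N. exp 2) = exp (66 * real N)"
    by (simp flip: exp_of_nat_mult exp_add)
  finally show ?thesis by simp
qed

text \<open>Rounding towards zero, unlike rounding to the nearest integer, never increases the norm
  and so keeps the lattice point inside the ball.\<close>

lemma obtain_round_towards_zero:
  fixes r :: real
  obtains z :: int where "\<bar>real_of_int z\<bar> \<le> \<bar>r\<bar>" "\<bar>r - real_of_int z\<bar> \<le> 1"
proof (cases "r \<ge> 0")
  case True
  then have "0 \<le> real_of_int \<lfloor>r\<rfloor>" by simp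
  then show ?thesis using True floor_correct[of r] by (intro that[of "\<lfloor>r\<rfloor>"]) linarith+
next
  case False
  then have "real_of_int \<lceil>r\<rceil> \<le> 0" by simp
  then show ?thesis using False ceiling_correct[of r] by (intro that[of "\<lceil>r\<rceil>"]) linarith+
qed

lemma scaled_net: "(\<Sum>i<N. (scaled N z i)\<^sup>2) \<le> 1" if "z \<in> net N"
proof -
  have "(\<Sum>i<N. (scaled N z i)\<^sup>2) = (\<Sum>i<N. (real_of_int (z i))\<^sup>2) / (64 * real N)"
    by (simp add: scaled_def power_divide power_mult_distrib sum_divide_distrib)
  then show ?thesis using that by (cases "N = 0") (auto simp: net_def divide_le_eq)
qed

lemma net_approximation:
  assumes N: "1 \<le> N" and x: "(\<Sum>i<N. (x i)\<^sup>2) \<le> 1"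
  obtains z where "z \<in> net N" "(\<Sum>i<N. (x i - scaled N z i)\<^sup>2) \<le> 1 / 64"
proof -
  define s where "s = 8 * sqrt (real N)"
  have s: "s > 0" "s\<^sup>2 = 64 * real N" using N by (auto simp: s_def power_mult_distrib)
  have "\<exists>z :: int. \<bar>real_of_int z\<bar> \<le> \<bar>s * x i\<bar> \<and> \<bar>s * x i - real_of_int z\<bar> \<le> 1" for i
    using obtain_round_towards_zero[of "s * x i"] by metis
  then obtain Z :: "nat \<Rightarrow> int" where Z: "\<And>i. \<bar>real_of_int (Z i)\<bar> \<le> \<bar>s * x i\<bar>" "\<And>i. \<bar>s * x i - real_of_int (Z i)\<bar> \<le> 1"
    by metis
  define z where "z = restrict Z {..<N}"
  have z: "z i = Z i" if "i < N" for i using that by (simp add: z_def)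
  have "(\<Sum>i<N. (real_of_int (z i))\<^sup>2) \<le> (\<Sum>i<N. s\<^sup>2 * (x i)\<^sup>2)"
  proof (intro sum_mono)
    fix i assume "i \<in> {..<N}"
    then show "(real_of_int (z i))\<^sup>2 \<le> s\<^sup>2 * (x i)\<^sup>2"
      using Z(1)[of i] z by (simp add: abs_le_square_iff power_mult_distrib)
  qed
  also have "\<dots> = 64 * real N * (\<Sum>i<N. (x i)\<^sup>2)" by (simp add: s flip: sum_distrib_left)
  also have "\<dots> \<le> 64 * real N" using x by (simp add: mult_left_le)
  finally have sq: "(\<Sum>i<N. (real_of_int (z i))\<^sup>2) \<le> 64 * real N" .
  have "z i \<in> {-(64 * int N)..64 * int N}" if "i < N" for i
  proof -
    have "(real_of_int (z i))\<^sup>2 \<le> (\<Sum>i<N. (real_of_int (z i))\<^sup>2)"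
      using that by (intro member_le_sum) auto
    then have "real_of_int ((z i)\<^sup>2) \<le> real_of_int (64 * int N)" using sq by simp
    then have "(z i)\<^sup>2 \<le> 64 * int N" by linarith
    moreover have "\<bar>z i\<bar> \<le> (z i)\<^sup>2"
      using self_le_power[of "\<bar>z i\<bar>" 2] by (cases "z i = 0") auto
    ultimately show ?thesis by auto
  qed
  then have "z \<in> net N" using sq by (auto simp: net_def z_def)
  moreover have "(\<Sum>i<N. (x i - scaled N z i)\<^sup>2) \<le> 1 / 64"
  proof -
    have "(\<Sum>i<N. (x i - scaled N z i)\<^sup>2) \<le> (\<Sum>i<N. 1 / s\<^sup>2)"
    proof (intro sum_mono)
      fix i assume "i \<in> {..<N}"
      then have "x i - scaled N z i = (s * x i - real_of_int (Z i)) / s"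
        using s z by (simp add: scaled_def s_def[symmetric] diff_divide_distrib)
      moreover have "(s * x i - real_of_int (Z i))\<^sup>2 \<le> 1"
        using Z(2)[of i] by (simp add: abs_square_le_1)
      ultimately show "(x i - scaled N z i)\<^sup>2 \<le> 1 / s\<^sup>2"
        by (simp add: power_divide divide_right_mono)
    qed
    also have "\<dots> = 1 / 64" using s N by simp
    finally show ?thesis .
  qed
  ultimately show ?thesis using that by blast
qed

lemma coupling_form_scale: "coupling_form N g (\<lambda>i. c * x i) = c\<^sup>2 * coupling_form N g x"
  by (simp add: coupling_form_def power2_eq_square sum_distrib_left mult_ac)

text \<open>The best constant \<open>S\<close> in \<open>\<bar>coupling_form N g x\<bar> \<le> S * |x|\<^sup>2\<close> satisfies \<open>S \<le> B + S / 4\<close>, because rounding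
  to the net changes the form by at most \<open>S / 4\<close>.\<close>

lemma coupling_form_bound_from_net:
  assumes N: "1 \<le> N"
    and net: "\<And>z. z \<in> net N \<Longrightarrow> \<bar>coupling_form N g (scaled N z)\<bar> \<le> B"
  shows "\<bar>coupling_form N g x\<bar> \<le> 2 * B * (\<Sum>i<N. (x i)\<^sup>2)"
proof -
  let ?F = "coupling_form N g"
  define q where "q x = (\<Sum>i<N. (x i)\<^sup>2)" for x :: "nat \<Rightarrow> real"
  have q_nonneg: "q x \<ge> 0" for x unfolding q_def by (intro sum_nonneg) auto
  define D where "D = {x. q x \<le> 1}"
  define S where "S = (SUP x\<in>D. \<bar>?F x\<bar>)"
  have bdd: "bdd_above ((\<lambda>x. \<bar>?F x\<bar>) ` D)"
  proof (intro bdd_aboveI2)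
    fix x assume x: "x \<in> D"
    have le1: "\<bar>x i\<bar> \<le> 1" if "i < N" for i
    proof -
      have "(x i)\<^sup>2 \<le> q x" unfolding q_def using that by (intro member_le_sum) auto
      then have "(x i)\<^sup>2 \<le> 1" using x by (simp add: D_def)
      then show ?thesis by (simp add: abs_square_le_1)
    qed
    have "\<bar>?F x\<bar> \<le> (\<Sum>i<N. \<Sum>j<N. \<bar>coupling g i j * x i * x j\<bar>)"
      unfolding coupling_form_def by (rule order_trans[OF sum_abs]) (intro sum_mono sum_abs)
    also have "\<dots> \<le> (\<Sum>i<N. \<Sum>j<N. \<bar>coupling g i j\<bar> * 1 * 1)"
      unfolding abs_mult by (intro sum_mono mult_mono le1) auto
    finally show "\<bar>?F x\<bar> \<le> (\<Sum>i<N. \<Sum>j<N. \<bar>coupling g i j\<bar> * 1 * 1)" .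
  qed
  have hom: "\<bar>?F x\<bar> \<le> S * q x" for x
  proof (cases "q x = 0")
    case True
    then have "x i = 0" if "i < N" for i
      using that sum_nonneg_eq_0_iff[of "{..<N}" "\<lambda>i. (x i)\<^sup>2"] by (simp add: q_def)
    then show ?thesis using True by (simp add: coupling_form_def)
  next
    case False
    then have pos: "q x > 0" using q_nonneg[of x] by simp
    define c where "c = 1 / sqrt (q x)"
    have c: "c\<^sup>2 = 1 / q x" using pos by (simp add: c_def power_divide)
    have "q (\<lambda>i. c * x i) = c\<^sup>2 * q x" by (simp add: q_def power_mult_distrib sum_distrib_left)
    then have "(\<lambda>i. c * x i) \<in> D" using c pos by (simp add: D_def)
    then have "\<bar>?F (\<lambda>i. c * x i)\<bar> \<le> S" unfolding S_def by (rule cSUP_upper[OF _ bdd])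
    then show ?thesis using pos by (simp add: coupling_form_scale abs_mult c divide_le_eq)
  qed
  have "(\<lambda>_. 0) \<in> D" by (simp add: D_def q_def)
  then have S_nonneg: "S \<ge> 0" unfolding S_def by (intro cSUP_upper2[OF bdd]) auto
  have "S \<le> B + S / 4"
    unfolding S_def
  proof (rule cSUP_least)
    show "D \<noteq> {}" using \<open>(\<lambda>_. 0) \<in> D\<close> by blast
    fix x assume "x \<in> D"
    then obtain z where z: "z \<in> net N" "q (\<lambda>i. x i - scaled N z i) \<le> 1 / 64"
      using net_approximation[OF N, of x] unfolding D_def q_def by blast
    have "q (scaled N z) \<le> 1" unfolding q_def by (rule scaled_net[OF z(1)])
    define y where "y = scaled N z"
    \<comment> \<open>Polarisation: the forms at \<open>u\<close> and \<open>w\<close> differ by 4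
      times the difference of those at \<open>x\<close> and \<open>y\<close>. The weights 1/4 and 4
      are balanced so that |u|^2 + |w|^2 is at most 1/4 + 1/4 + 32/64 = 1.\<close>
    define u where "u i = (x i + y i) / 4 + 4 * (x i - y i)" for i
    define w where "w i = (x i + y i) / 4 - 4 * (x i - y i)" for i
    have uw: "u i * u j - w i * w j = 4 * (x i * x j - y i * y j)" for i j
      by (simp add: u_def w_def field_simps)
    have "coupling g i j * u i * u j - coupling g i j * w i * w j
        = 4 * (coupling g i j * x i * x j - coupling g i j * y i * y j)" for i j
      using arg_cong[OF uw[of i j], of "\<lambda>s. coupling g i j * s"] by (simp add: algebra_simps)
    then have "?F u - ?F w = 4 * (?F x - ?F y)"
      by (simp add: coupling_form_def sum_distrib_left flip: sum_subtractf)
    moreover have "q u + q w \<le> q x / 4 + q y / 4 + 32 * q (\<lambda>i. x i - y i)"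
    proof -
      have "q u + q w \<le> (\<Sum>i<N. (x i)\<^sup>2 / 4 + (y i)\<^sup>2 / 4 + 32 * (x i - y i)\<^sup>2)"
        unfolding q_def sum.distrib[symmetric]
      proof (intro sum_mono)
        fix i
        have "(u i)\<^sup>2 + (w i)\<^sup>2 = (x i + y i)\<^sup>2 / 8 + 32 * (x i - y i)\<^sup>2"
          by (simp add: u_def w_def power2_eq_square field_simps)
        moreover have "(x i + y i)\<^sup>2 \<le> 2 * (x i)\<^sup>2 + 2 * (y i)\<^sup>2"
          using sum_squares_bound[of "x i" "y i"] by (simp add: power2_sum)
        ultimately show "(u i)\<^sup>2 + (w i)\<^sup>2 \<le> (x i)\<^sup>2 / 4 + (y i)\<^sup>2 / 4 + 32 * (x i - y i)\<^sup>2"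
          by simp
      qed
      then show ?thesis by (simp add: q_def sum.distrib sum_divide_distrib sum_distrib_left)
    qed
    then have "q u + q w \<le> 1" using z(2) \<open>q (scaled N z) \<le> 1\<close> \<open>x \<in> D\<close> by (simp add: D_def y_def)
    then have "S * (q u + q w) \<le> S" using S_nonneg mult_left_le by blast
    then have "\<bar>?F u\<bar> + \<bar>?F w\<bar> \<le> S"
      using hom[of u] hom[of w] by (simp add: distrib_left)
    moreover have "\<bar>?F y\<bar> \<le> B" unfolding y_def by (rule net[OF z(1)])
    moreover have "\<bar>a\<bar> \<le> B + S / 4" if "c - d = 4 * (a - b)" "\<bar>c\<bar> + \<bar>d\<bar> \<le> S" "\<bar>b\<bar> \<le> B" for a b c d :: real
      using that by (simp add: abs_le_iff abs_if split: if_splits)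
    ultimately have "\<bar>?F x\<bar> \<le> B + S / 4" by blast
    then show "\<bar>?F x\<bar> \<le> B + (SUP x\<in>D. \<bar>?F x\<bar>) / 4" by (simp add: S_def)
  qed
  \<comment> \<open>The inequality gives \<open>4 * B / 3\<close>; 2 is a round constant above
    4/3.\<close>
  then have "S \<le> 2 * B" using S_nonneg by simp
  then have "S * q x \<le> 2 * B * q x" by (intro mult_right_mono q_nonneg)
  then show ?thesis using hom[of x] unfolding q_def by linarith
qed

section \<open>Gaussian exponential moments and the exceptional disorder\<close>

lemma std_gauss_exp: "has_bochner_integral std_gauss (\<lambda>x. exp (c * x)) (exp (c\<^sup>2 / 2))"
proof -
  have "has_bochner_integral lborel (\<lambda>x. (1 / sqrt (2 * pi)) * exp (x * c - x\<^sup>2 / 2))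
      (1 / sqrt (2 * pi) * (sqrt (2 * pi) * exp (c\<^sup>2 / 2)))"
    by (intro has_bochner_integral_mult_right gaussian_exp_linear)
  moreover have "exp (x * c - x\<^sup>2 / 2) = exp (- x\<^sup>2 / 2) * exp (c * x)" for x
    by (simp flip: exp_add)
  ultimately have "has_bochner_integral lborel (\<lambda>x. std_normal_density x *\<^sub>R exp (c * x)) (exp (c\<^sup>2 / 2))"
    by (simp add: std_normal_density_def mult.assoc)
  then show ?thesis
    unfolding std_gauss_def by (intro has_bochner_integral_density) auto
qed

lemma finite_pairs [simp]: "finite (pairs N)"
  by (rule finite_subset[of _ "{..<N} \<times> {..<N}"]) (auto simp: pairs_def)

lemma disorder_exp_linear:
  "integrable (disorder N) (\<lambda>g. exp (\<Sum>p\<in>pairs N. c p * g p))"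
  "(\<integral>g. exp (\<Sum>p\<in>pairs N. c p * g p) \<partial>disorder N) = exp ((\<Sum>p\<in>pairs N. (c p)\<^sup>2) / 2)"
proof -
  interpret prob_space std_gauss
    unfolding std_gauss_def by (rule prob_space_normal_density) simp
  interpret P: product_sigma_finite "\<lambda>_ :: nat \<times> nat. std_gauss"
    by standard
  have "integrable std_gauss (\<lambda>x. exp (c p * x))" "(\<integral>x. exp (c p * x) \<partial>std_gauss) = exp ((c p)\<^sup>2 / 2)" for p
    using std_gauss_exp[of "c p"] by (auto simp: has_bochner_integral_iff)
  then show "integrable (disorder N) (\<lambda>g. exp (\<Sum>p\<in>pairs N. c p * g p))"
    "(\<integral>g. exp (\<Sum>p\<in>pairs N. c p * g p) \<partial>disorder N) = exp ((\<Sum>p\<in>pairs N. (c p)\<^sup>2) / 2)"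
    using P.product_integrable_prod[of "pairs N" "\<lambda>p x. exp (c p * x)"]
      P.product_integral_prod[of "pairs N" "\<lambda>p x. exp (c p * x)"]
    by (auto simp: disorder_def exp_sum sum_divide_distrib)
qed

lemma prob_space_disorder: "prob_space (disorder N)"
proof -
  have "prob_space std_gauss"
    unfolding std_gauss_def by (rule prob_space_normal_density) simp
  then show ?thesis unfolding disorder_def by (intro prob_space_PiM)
qed

text \<open>For fixed \<open>y\<close> the form is centred Gaussian; its variance, 4 times the sum
  of y_i^2 y_j^2 over the pairs, is at most 2 |y|^4 \<le> 2.\<close>

lemma disorder_exp_coupling_form:
  assumes y: "(\<Sum>i<N. (y i)\<^sup>2) \<le> 1"
  shows "integrable (disorder N) (\<lambda>g. exp (c * coupling_form N g y))"
    "(\<integral>g. exp (c * coupling_form N g y) \<partial>disorder N) \<le> exp (c\<^sup>2)"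
proof -
  define d where "d p = c * (2 * y (fst p) * y (snd p))" for p
  have eq: "c * coupling_form N g y = (\<Sum>p\<in>pairs N. d p * g p)" for g
    by (simp add: coupling_form_pairs d_def sum_distrib_left mult_ac)
  show "integrable (disorder N) (\<lambda>g. exp (c * coupling_form N g y))"
    unfolding eq by (rule disorder_exp_linear)
  \<comment> \<open>Half the variance is itself a value of the form, with y_i y_j in place of the
    disorder.\<close>
  have "coupling_form N (\<lambda>(i, j). y i * y j) y \<le> (\<Sum>i<N. \<Sum>j<N. (y i)\<^sup>2 * (y j)\<^sup>2)"
    unfolding coupling_form_def
  proof (intro sum_mono)
    fix i j
    show "coupling (\<lambda>(i, j). y i * y j) i j * y i * y j \<le> (y i)\<^sup>2 * (y j)\<^sup>2"
    proof (cases "i = j")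
      case False then show ?thesis by (simp add: coupling_def power2_eq_square mult_ac)
    qed (simp add: coupling_def)
  qed
  also have "\<dots> = (\<Sum>i<N. (y i)\<^sup>2)\<^sup>2" by (simp add: power2_eq_square[of "sum _ _"] sum_product)
  also have "\<dots> \<le> 1" using y by (intro power_le_one sum_nonneg) auto
  finally have "coupling_form N (\<lambda>(i, j). y i * y j) y \<le> 1" .
  moreover have "(\<Sum>p\<in>pairs N. (d p)\<^sup>2) = 2 * c\<^sup>2 * coupling_form N (\<lambda>(i, j). y i * y j) y"
    by (simp add: coupling_form_pairs d_def sum_distrib_left power2_eq_square case_prod_beta mult_ac)
  ultimately have "(\<Sum>p\<in>pairs N. (d p)\<^sup>2) \<le> 2 * c\<^sup>2"
    by (simp add: mult_left_le)
  then show "(\<integral>g. exp (c * coupling_form N g y) \<partial>disorder N) \<le> exp (c\<^sup>2)"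
    unfolding eq disorder_exp_linear by simp
qed

text \<open>Exponential Chebyshev with parameter \<open>9 * sqrt N\<close> and a union bound: each of the at most \<open>exp (66 * N)\<close>
  points contributes mean at most \<open>2 * exp (81 * N - 153 * N)\<close>, where \<open>153 = 9 * 17\<close> encodes the threshold \<open>17 * sqrt N\<close>.\<close>

definition net_excess :: "nat \<Rightarrow> (nat \<times> nat \<Rightarrow> real) \<Rightarrow> real" where
  "net_excess N g = (\<Sum>z\<in>net N. exp (- 153 * real N) *
     (exp (9 * sqrt N * coupling_form N g (scaled N z)) + exp (- 9 * sqrt N * coupling_form N g (scaled N z))))"

lemma net_excess_nonneg: "0 \<le> net_excess N g"
  unfolding net_excess_def by (intro sum_nonneg) auto

text \<open>Makes \<open>net_excess\<close> an integrable majorant of the indicator of the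
  exceptional event.\<close>

lemma net_excess_ge_1:
  assumes z: "z \<in> net N" "\<bar>coupling_form N g (scaled N z)\<bar> > 17 * sqrt N"
  shows "1 \<le> net_excess N g"
proof -
  let ?F = "coupling_form N g (scaled N z)"
  have "9 * sqrt N * (17 * sqrt N) \<le> 9 * sqrt N * \<bar>?F\<bar>"
    using z(2) by (intro mult_left_mono) auto
  then have "153 * real N \<le> 9 * sqrt N * \<bar>?F\<bar>" by simp
  then have "exp (153 * real N) \<le> exp (9 * sqrt N * \<bar>?F\<bar>)" by simp
  also have "\<dots> \<le> exp (9 * sqrt N * ?F) + exp (- 9 * sqrt N * ?F)"
    by (auto simp: abs_if)
  finally have "exp (- 153 * real N) * exp (153 * real N)
      \<le> exp (- 153 * real N) * (exp (9 * sqrt N * ?F) + exp (- 9 * sqrt N * ?F))"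
    by (intro mult_left_mono) auto
  moreover have "exp (- 153 * real N) * exp (153 * real N) = 1"
    by (simp flip: exp_add)
  ultimately have "1 \<le> exp (- 153 * real N) * (exp (9 * sqrt N * ?F) + exp (- 9 * sqrt N * ?F))"
    by metis
  also have "\<dots> \<le> net_excess N g"
    unfolding net_excess_def by (rule member_le_sum[OF z(1)]) auto
  finally show ?thesis .
qed

lemma integrable_net_excess: "integrable (disorder N) (net_excess N)"
  unfolding net_excess_def
  by (intro Bochner_Integration.integrable_sum integrable_mult_right Bochner_Integration.integrable_add
      disorder_exp_coupling_form scaled_net)

lemma integral_net_excess: "(\<integral>g. net_excess N g \<partial>disorder N) \<le> 2 * exp (- real N)"
proof -
  have sq: "(9 * sqrt N)\<^sup>2 = 81 * real N" "(- 9 * sqrt N)\<^sup>2 = 81 * real N"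
    by (simp_all add: power_mult_distrib)
  have "(\<integral>g. net_excess N g \<partial>disorder N) = (\<Sum>z\<in>net N. exp (- 153 * real N) *
      ((\<integral>g. exp (9 * sqrt N * coupling_form N g (scaled N z)) \<partial>disorder N)
       + (\<integral>g. exp (- 9 * sqrt N * coupling_form N g (scaled N z)) \<partial>disorder N)))"
    unfolding net_excess_def
  proof (subst Bochner_Integration.integral_sum)
    fix z assume "z \<in> net N"
    note int = disorder_exp_coupling_form(1)[OF scaled_net[OF this]]
    show "integrable (disorder N) (\<lambda>g. exp (- 153 * real N) *
        (exp (9 * sqrt N * coupling_form N g (scaled N z)) + exp (- 9 * sqrt N * coupling_form N g (scaled N z))))"
      by (intro integrable_mult_right Bochner_Integration.integrable_add int)
  next
    show "(\<Sum>z\<in>net N. \<integral>g. exp (- 153 * real N) *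
        (exp (9 * sqrt N * coupling_form N g (scaled N z)) + exp (- 9 * sqrt N * coupling_form N g (scaled N z))) \<partial>disorder N)
      = (\<Sum>z\<in>net N. exp (- 153 * real N) *
        ((\<integral>g. exp (9 * sqrt N * coupling_form N g (scaled N z)) \<partial>disorder N)
         + (\<integral>g. exp (- 9 * sqrt N * coupling_form N g (scaled N z)) \<partial>disorder N)))"
    proof (rule sum.cong[OF refl])
      fix z assume "z \<in> net N"
      note int = disorder_exp_coupling_form(1)[OF scaled_net[OF this]]
      show "(\<integral>g. exp (- 153 * real N) *
          (exp (9 * sqrt N * coupling_form N g (scaled N z)) + exp (- 9 * sqrt N * coupling_form N g (scaled N z))) \<partial>disorder N)
        = exp (- 153 * real N) * ((\<integral>g. exp (9 * sqrt N * coupling_form N g (scaled N z)) \<partial>disorder N)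
           + (\<integral>g. exp (- 9 * sqrt N * coupling_form N g (scaled N z)) \<partial>disorder N))"
        by (simp only: integral_mult_right_zero Bochner_Integration.integral_add[OF int int])
    qed
  qed
  also have "\<dots> \<le> (\<Sum>z\<in>net N. exp (- 153 * real N) * (exp (81 * real N) + exp (81 * real N)))"
    using disorder_exp_coupling_form(2)[OF scaled_net, of _ N] sq
    by (intro sum_mono mult_left_mono add_mono) (metis, metis, simp)
  \<comment> \<open>The exponent is 81 - 153 = -72 per site, of which the cardinality of the net
    uses up 66.\<close>
  also have "\<dots> = real (card (net N)) * (2 * exp (- 72 * real N))"
    by (simp flip: exp_add)
  also have "\<dots> \<le> exp (66 * real N) * (2 * exp (- 72 * real N))"
    by (intro mult_right_mono card_net) auto
  also have "\<dots> = 2 * exp (- 6 * real N)" by (simp flip: exp_add)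
  also have "\<dots> \<le> 2 * exp (- real N)" by simp
  finally show ?thesis .
qed

section \<open>Averaging over the disorder\<close>

lemma nu_moment_bound:
  assumes \<beta>: "0 < \<beta>" "\<beta> \<le> 1 / 204" and N: "1 \<le> N" and t: "(\<Sum>i<N. (t i)\<^sup>2) = 1" and k: "1 \<le> k"
  shows "nu N \<beta> h (\<lambda>\<sigma>1 \<sigma>2. (\<Sum>i<N. t i * (\<sigma>1 i - \<sigma>2 i)) ^ (2 * k)) \<le> (16 * exp 2 * real k) ^ k"
proof -
  let ?f = "\<lambda>\<sigma>1 \<sigma>2. (\<Sum>i<N. t i * (\<sigma>1 i - \<sigma>2 i)) ^ (2 * k)"
  \<comment> \<open>One pointwise bound for all disorder: the second summand exceeds the trivial
    bound as soon as some net point passes the threshold.\<close>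
  let ?R = "\<lambda>g. (8 * exp 2 * real k) ^ k + (4 * real N) ^ k * net_excess N g"
  interpret prob_space "disorder N" by (rule prob_space_disorder)
  have point: "gibbs2 N \<beta> h g ?f \<le> ?R g" for g
  proof (cases "\<forall>z\<in>net N. \<bar>coupling_form N g (scaled N z)\<bar> \<le> 17 * sqrt N")
    case True
    have "gibbs2 N \<beta> h g ?f \<le> (8 * exp 2 * real k) ^ k"
    proof (rule gibbs2_moment_good_disorder[OF N t \<beta>(1) _ k])
      \<comment> \<open>The threshold 17 on the net becomes 34 on all vectors, and 34 * 6 =
        204.\<close>
      show "\<beta> * 34 \<le> 1 / 6" using \<beta> by simp
      show "\<bar>coupling_form N g x\<bar> \<le> 34 * sqrt N * (\<Sum>i<N. (x i)\<^sup>2)" for x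
        using coupling_form_bound_from_net[OF N, of g "17 * sqrt N" x] True by simp
    qed
    moreover have "0 \<le> (4 * real N) ^ k * net_excess N g" by (simp add: net_excess_nonneg)
    ultimately show ?thesis by linarith
  next
    case False
    then have "1 \<le> net_excess N g" using net_excess_ge_1 by (auto simp: not_le)
    then have "(4 * real N) ^ k * 1 \<le> (4 * real N) ^ k * net_excess N g"
      by (intro mult_left_mono) auto
    moreover have "0 \<le> (8 * exp 2 * real k) ^ k" by simp
    ultimately show ?thesis using gibbs2_moment_trivial[OF t, of \<beta> h g k] by linarith
  qed
  have "nu N \<beta> h ?f \<le> (\<integral>g. ?R g \<partial>disorder N)"
    unfolding nu_def
  \<comment> \<open>Integrability of the majorant suffices: a non-integrable left side has integral
    0, below the nonnegative right side.\<close>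
  proof (rule integral_mono')
    show "integrable (disorder N) ?R" by (auto intro!: integrable_net_excess)
    show "gibbs2 N \<beta> h g ?f \<le> ?R g" for g by (rule point)
    show "0 \<le> ?R g" for g by (simp add: net_excess_nonneg)
  qed
  also have "\<dots> = (8 * exp 2 * real k) ^ k + (4 * real N) ^ k * (\<integral>g. net_excess N g \<partial>disorder N)"
    by (subst Bochner_Integration.integral_add) (auto intro!: integrable_net_excess simp: prob_space)
  also have "\<dots> \<le> (8 * exp 2 * real k) ^ k + (4 * real N) ^ k * (2 * exp (- real N))"
    by (intro add_left_mono mult_left_mono integral_net_excess) auto
  also have "(4 * real N) ^ k * (2 * exp (- real N)) \<le> (8 * exp 2 * real k) ^ k"
  proof -
    have "real N ^ k * exp (- real N) \<le> fact k"
      using power_le_fact_exp[of "real N" k] by (simp add: exp_minus field_simps)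
    also have "\<dots> \<le> real k ^ k" using fact_le_power[of k, where 'a = real] by simp
    finally have "4 ^ k * 2 * (real N ^ k * exp (- real N)) \<le> 4 ^ k * 2 ^ k * real k ^ k"
      using power_increasing[OF k, of "2 :: real"] by (intro mult_mono) auto
    also have "\<dots> = (8 * real k) ^ k" unfolding power_mult_distrib[symmetric] by (simp add: power_mult_distrib)
    also have "\<dots> \<le> (8 * exp 2 * real k) ^ k"
      using mult_right_mono[of 1 "exp 2" "real k"] by (intro power_mono) auto
    finally show ?thesis by (simp add: power_mult_distrib mult_ac)
  qed
  \<comment> \<open>Both summands now have the same bound, and \<open>2 \<le> 2 ^ k\<close> moves
    the doubling into the constant.\<close>
  also have "(8 * exp 2 * real k) ^ k + (8 * exp 2 * real k) ^ k \<le> 2 ^ k * (8 * exp 2 * real k) ^ k"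
    using mult_right_mono[OF power_increasing[OF k, of "2 :: real"], of "(8 * exp 2 * real k) ^ k"] by simp
  also have "\<dots> = (16 * exp 2 * real k) ^ k" unfolding power_mult_distrib[symmetric] by (simp add: power_mult_distrib)
  finally show ?thesis by simp
qed

theorem theorem2:
  shows "\<exists>\<beta>0 L :: real. \<beta>0 > 0 \<and> L > 0 \<and>
    (\<forall>\<beta> h N (t :: nat \<Rightarrow> real) (k :: nat).
       0 < \<beta> \<longrightarrow> \<beta> \<le> \<beta>0 \<longrightarrow> 0 \<le> h \<longrightarrow> 1 \<le> N \<longrightarrow>
       (\<Sum>i<N. (t i)\<^sup>2) = 1 \<longrightarrow> 1 \<le> k \<longrightarrow>
       nu N \<beta> h (\<lambda>\<sigma>1 \<sigma>2. (\<Sum>i<N. t i * (\<sigma>1 i - \<sigma>2 i)) ^ (2 * k))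
         \<le> (L * real k) ^ k)"
proof (rule exI[of _ "1 / 204"], rule exI[of _ "16 * exp 2"], intro conjI allI impI)
  fix \<beta> h :: real and N k :: nat and t :: "nat \<Rightarrow> real"
  assume "0 < \<beta>" "\<beta> \<le> 1 / 204" "1 \<le> N" "(\<Sum>i<N. (t i)\<^sup>2) = 1" "1 \<le> k"
  then show "nu N \<beta> h (\<lambda>\<sigma>1 \<sigma>2. (\<Sum>i<N. t i * (\<sigma>1 i - \<sigma>2 i)) ^ (2 * k)) \<le> (16 * exp 2 * real k) ^ k"
    by (rule nu_moment_bound)
qed simp_all

end
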